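(* Let $X$ be an infinite zero-dimensional Hausdorff space and let $G \le \mathrm{Homeo}(X)$ be the piecewise full group of some group of homeomorphisms of $X$. Suppose that the action of $G$ on $X$ is compressible and let $H$ be the subgroup of $G$ generated by the rigid stabilisers $\mathrm{rist}_G(Y)$ of $G$-compressible clopen sets $Y \subseteq X$. Then $G$ is almost simple with monolith $\mathrm{D}(H)$. If $X$ is compact and the action of $G$ is minimal, then $G = H$ and the action of $\mathrm{D}(G)$ on $X$ is fully compressible.
   Context: Zero-dimensional means having a base of clopen sets. For $K \le \mathrm{Homeo}(X)$, the piecewise full group $\mathrm{F}(K)$ consists of all homeomorphisms $\phi$ of $X$ for which there are an open cover $\mathcal{O}$ of $X$ and elements $g_O \in K$ ($O \in \mathcal{O}$) such that $\phi(x) = g_O(x)$ for all $x \in O \in \mathcal{O}$. For a group $K$ acting on $X$ by homeomorphisms, a subset $Y \subseteq X$ is $K$-compressible if for every non-empty open $O \subseteq X$ there is $g \in K$ with $gY \subseteq O$. The action of $K$ is compressible if a non-empty $K$-compressible open subset exists, and fully compressible if every non-dense open set is $K$-compressible. The action is minimal if every orbit is dense. $\mathrm{rist}_G(Y)$ is the subgroup of elements of $G$ fixing every point of $X \setminus Y$. $\mathrm{D}(\cdot)$ denotes the derived subgroup. The monolith of a group is the intersection of all its non-trivial normal subgroups; a group is almost simple if its monolith is non-abelian and simple.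
   Formalization: The claim that the monolith of G is D(H) is stated only for X without isolated points; otherwise it is false: every G-compressible set then has at most one point, so H is trivial (e.g. X = ℕ discrete, G = Sym(ℕ)). All other claims are unrestricted. *)

theory Defs
  imports "HOL-Analysis.Analysis" "HOL-Algebra.Generated_Groups"
begin

text \<open>
  The space \<open>X\<close> is a type of class \<^class>\<open>t2_space\<close> (or just \<^class>\<open>topological_space\<close>), so \<open>X\<close> is
  \<^term>\<open>UNIV\<close>, and a group acting on \<open>X\<close> is a subgroup of the group of all homeomorphisms of \<open>X\<close>,
  given by its carrier.
\<close>

definition zero_dimensional :: "'a::topological_space itself \<Rightarrow> bool" where
  "zero_dimensional _ \<longleftrightarrow>
     (\<exists>B :: 'a set set. topological_basis B \<and> (\<forall>U\<in>B. open U \<and> closed U))"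

definition homeo_group :: "('a::topological_space \<Rightarrow> 'a) monoid" where
  "homeo_group =
     \<lparr>carrier = {f. \<exists>g. homeomorphism UNIV UNIV f g}, monoid.mult = (\<lambda>f g. f \<circ> g), one = id\<rparr>"

definition piecewise_full :: "('a::topological_space \<Rightarrow> 'a) set \<Rightarrow> ('a \<Rightarrow> 'a) set" where
  "piecewise_full K =
     {\<phi> \<in> carrier homeo_group.
        \<exists>\<O>. (\<forall>U\<in>\<O>. open U) \<and> \<Union>\<O> = UNIV \<and> (\<forall>U\<in>\<O>. \<exists>g\<in>K. \<forall>x\<in>U. \<phi> x = g x)}"

definition compressible_set :: "('a::topological_space \<Rightarrow> 'a) set \<Rightarrow> 'a set \<Rightarrow> bool" where
  "compressible_set K Y \<longleftrightarrow> (\<forall>U. open U \<and> U \<noteq> {} \<longrightarrow> (\<exists>g\<in>K. g ` Y \<subseteq> U))"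

definition compressible_action :: "('a::topological_space \<Rightarrow> 'a) set \<Rightarrow> bool" where
  "compressible_action K \<longleftrightarrow> (\<exists>Y. open Y \<and> Y \<noteq> {} \<and> compressible_set K Y)"

definition fully_compressible_action :: "('a::topological_space \<Rightarrow> 'a) set \<Rightarrow> bool" where
  "fully_compressible_action K \<longleftrightarrow>
     (\<forall>Y. open Y \<and> closure Y \<noteq> UNIV \<longrightarrow> compressible_set K Y)"

definition minimal_action :: "('a::topological_space \<Rightarrow> 'a) set \<Rightarrow> bool" where
  "minimal_action K \<longleftrightarrow> (\<forall>x. closure {g x |g. g \<in> K} = UNIV)"

definition rist :: "('a \<Rightarrow> 'a) set \<Rightarrow> 'a set \<Rightarrow> ('a \<Rightarrow> 'a) set" where
  "rist K Y = {g \<in> K. \<forall>x. x \<notin> Y \<longrightarrow> g x = x}"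

text \<open>
  The intersection is formed inside the group, so that the monolith of the trivial group, which
  has no non-trivial normal subgroup, is the group itself and not \<open>UNIV\<close>.
\<close>

definition monolith :: "('g, 'b) monoid_scheme \<Rightarrow> 'g set" where
  "monolith \<G> = carrier \<G> \<inter> \<Inter>{N. N \<lhd> \<G> \<and> N \<noteq> {\<one>\<^bsub>\<G>\<^esub>}}"

text \<open>
  The locale \<open>simple_group\<close> of \<open>HOL-Algebra\<close> demands \<open>order G > 1\<close>, which fails for every infinite
  group, since infinite sets have cardinality \<open>0\<close>.
\<close>

definition is_simple :: "('g, 'b) monoid_scheme \<Rightarrow> bool" where
  "is_simple \<G> \<longleftrightarrow>
     group \<G> \<and> carrier \<G> \<noteq> {\<one>\<^bsub>\<G>\<^esub>} \<and> (\<forall>N. N \<lhd> \<G> \<longrightarrow> N = {\<one>\<^bsub>\<G>\<^esub>} \<or> N = carrier \<G>)"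

definition almost_simple :: "('g, 'b) monoid_scheme \<Rightarrow> bool" where
  "almost_simple \<G> \<longleftrightarrow>
     group \<G> \<and> is_simple (\<G>\<lparr>carrier := monolith \<G>\<rparr>) \<and>
     \<not> comm_group (\<G>\<lparr>carrier := monolith \<G>\<rparr>)"

end

theory Submission
  imports Defs
begin

text \<open>
  A subgroup \<open>D\<close> is a non-abelian simple monolith of \<open>G\<close> as soon as it is normal, non-abelian and
  contained in every non-trivial subgroup normalised by \<open>D\<close>. If \<open>n \<in> N\<close> moves a clopen set \<open>A\<close> off
  itself, then \<open>[f, h] = [[f, n], h] \<in> N\<close> for \<open>f\<close> and \<open>h\<close> supported in \<open>A\<close>, and compressibility
  transports this to all compressible supports. Without isolated points, the union of two compressible
  clopen sets is compressible unless it is the whole space, and \<open>3\<close>-cycles of disjoint copies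
  of a compressible set show that every element of \<open>G\<close> agrees on it with an element of \<open>D(H)\<close>;
  hence \<open>D = D(H)\<close> works. With an isolated point, the isolated points form a dense orbit on which
  \<open>G\<close> contains all transpositions, the compressible sets are the singletons of isolated points and the
  empty set, so \<open>H\<close> is trivial, and \<open>D\<close> is the alternating group of finitary even permutations of the
  isolated points.
\<close>

section \<open>Commutators and monoliths\<close>

context group
begin

text \<open>Together with \<open>m_assoc\<close> these rules reduce words in the group to
  right-nested normal form, cancelling a letter against its inverse even when a tail
  follows.\<close>

lemma inv_mult_cancel_left:
  assumes "x \<in> carrier G" "y \<in> carrier G"
  shows "x \<otimes> (inv x \<otimes> y) = y" and "inv x \<otimes> (x \<otimes> y) = y"
  using assms by (simp_all flip: m_assoc)

lemma subgroup_normalises_inv: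
  assumes "subgroup N G" "x \<in> carrier G" "n \<in> N" "x \<otimes> n \<otimes> inv x \<in> N"
  shows "x \<otimes> inv n \<otimes> inv x \<in> N"
proof -
  have "inv (x \<otimes> n \<otimes> inv x) \<in> N"
    using assms subgroup.m_inv_closed by metis
  moreover have "n \<in> carrier G" using assms subgroup.mem_carrier by metis
  ultimately show ?thesis using assms by (simp add: inv_mult_group m_assoc)
qed

text \<open>Conjugation by \<open>g\<close> is a homomorphism, so it is enough to control it on the
  letters; inverse letters are covered by \<open>subgroup_normalises_inv\<close>.\<close>

lemma generate_conj_closed:
  assumes R: "R \<subseteq> carrier G" and g: "g \<in> carrier G"
    and conj: "\<And>r. r \<in> R \<Longrightarrow> g \<otimes> r \<otimes> inv g \<in> generate G R"
    and x: "x \<in> generate G R"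
  shows "g \<otimes> x \<otimes> inv g \<in> generate G R"
  using x
proof (induction rule: generate.induct)
  case one
  then show ?case using g generate.one[of G R] by simp
next
  case (incl h)
  then show ?case using conj by simp
next
  case (inv h)
  then show ?case
    using subgroup_normalises_inv[OF generate_is_subgroup[OF R] g generate.incl conj] by blast
next
  case (eng h1 h2)
  have "h1 \<in> carrier G" "h2 \<in> carrier G" using eng generate_in_carrier[OF R] by auto
  then have "g \<otimes> (h1 \<otimes> h2) \<otimes> inv g = (g \<otimes> h1 \<otimes> inv g) \<otimes> (g \<otimes> h2 \<otimes> inv g)"
    using g by (simp add: m_assoc inv_mult_cancel_left)
  then show ?case using eng.IH generate.eng by metis
qed

text \<open>A conjugate of a commutator is the commutator of the conjugates.\<close>

lemma derived_conj_closed: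
  assumes H: "H \<subseteq> carrier G" and g: "g \<in> carrier G"
    and conj: "\<And>h. h \<in> H \<Longrightarrow> g \<otimes> h \<otimes> inv g \<in> H"
    and x: "x \<in> derived G H"
  shows "g \<otimes> x \<otimes> inv g \<in> derived G H"
  unfolding derived_def
proof (rule generate_conj_closed[OF derived_set_in_carrier[OF H] g])
  fix r assume "r \<in> derived_set G H"
  then obtain h k where hk: "h \<in> H" "k \<in> H" "r = h \<otimes> k \<otimes> inv h \<otimes> inv k" by blast
  define h' k' where "h' = g \<otimes> h \<otimes> inv g" and "k' = g \<otimes> k \<otimes> inv g"
  have "h \<in> carrier G" "k \<in> carrier G" using hk H by auto
  then have "g \<otimes> r \<otimes> inv g = h' \<otimes> k' \<otimes> inv h' \<otimes> inv k'"
    using g by (simp add: h'_def k'_def hk(3) m_assoc inv_mult_group inv_mult_cancel_left)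
  moreover have "h' \<in> H" "k' \<in> H" using hk conj by (auto simp: h'_def k'_def)
  ultimately show "g \<otimes> r \<otimes> inv g \<in> generate G (derived_set G H)"
    by (intro generate.incl) auto
qed (use x in \<open>simp add: derived_def\<close>)

text \<open>This is the centraliser of \<open>s\<close> modulo \<open>N\<close>, written without a
  quotient because \<open>N\<close> need not lie in \<open>L\<close>. Closure rests on [x^-1, s] =
  x^-1 [x, s]^-1 x and [xy, s] = x [y, s] x^-1 [x, s].\<close>

lemma subgroup_commuting_modulo:
  assumes N: "subgroup N G" and L: "subgroup L G" and s: "s \<in> L"
    and norm: "\<And>h n. h \<in> L \<Longrightarrow> n \<in> N \<Longrightarrow> h \<otimes> n \<otimes> inv h \<in> N"
  shows "subgroup {h \<in> L. h \<otimes> s \<otimes> inv h \<otimes> inv s \<in> N} G"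
proof -
  have car: "x \<in> L \<Longrightarrow> x \<in> carrier G" for x using L subgroup.mem_carrier by metis
  have carN: "x \<in> N \<Longrightarrow> x \<in> carrier G" for x using N subgroup.mem_carrier by metis
  show ?thesis
  proof (rule subgroup.intro)
    show "{h \<in> L. h \<otimes> s \<otimes> inv h \<otimes> inv s \<in> N} \<subseteq> carrier G" using car by auto
    show "\<one> \<in> {h \<in> L. h \<otimes> s \<otimes> inv h \<otimes> inv s \<in> N}"
      using L N s car by (auto simp: subgroup.one_closed)
  next
    fix x assume x: "x \<in> {h \<in> L. h \<otimes> s \<otimes> inv h \<otimes> inv s \<in> N}"
    define n where "n = x \<otimes> s \<otimes> inv x \<otimes> inv s"
    have n: "n \<in> N" "inv x \<in> L" "x \<in> L" using x L by (auto simp: n_def subgroup.m_inv_closed)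
    then have "inv x \<otimes> inv n \<otimes> inv (inv x) \<in> N"
      using norm N by (simp add: subgroup.m_inv_closed)
    moreover have "inv x \<otimes> inv n \<otimes> inv (inv x) = inv x \<otimes> s \<otimes> inv (inv x) \<otimes> inv s"
      using n s car by (simp add: n_def m_assoc inv_mult_group inv_mult_cancel_left)
    ultimately show "inv x \<in> {h \<in> L. h \<otimes> s \<otimes> inv h \<otimes> inv s \<in> N}" using n by simp
  next
    fix x y assume x: "x \<in> {h \<in> L. h \<otimes> s \<otimes> inv h \<otimes> inv s \<in> N}"
      and y: "y \<in> {h \<in> L. h \<otimes> s \<otimes> inv h \<otimes> inv s \<in> N}"
    then have "(x \<otimes> (y \<otimes> s \<otimes> inv y \<otimes> inv s) \<otimes> inv x) \<otimes> (x \<otimes> s \<otimes> inv x \<otimes> inv s) \<in> N"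
      using norm N by (simp add: subgroup.m_closed)
    moreover have "(x \<otimes> (y \<otimes> s \<otimes> inv y \<otimes> inv s) \<otimes> inv x) \<otimes> (x \<otimes> s \<otimes> inv x \<otimes> inv s)
        = (x \<otimes> y) \<otimes> s \<otimes> inv (x \<otimes> y) \<otimes> inv s"
      using x y s car by (simp add: m_assoc inv_mult_group inv_mult_cancel_left)
    ultimately show "x \<otimes> y \<in> {h \<in> L. h \<otimes> s \<otimes> inv h \<otimes> inv s \<in> N}"
      using x y L by (simp add: subgroup.m_closed)
  qed
qed

text \<open>Generators that commute modulo \<open>N\<close> generate a group that is abelian modulo
  \<open>N\<close>. The centraliser of a generator modulo \<open>N\<close> contains
  \<open>R\<close>, hence everything; since [h, s]^-1 = [s, h], the same argument then applies to
  the centraliser of an arbitrary element.\<close>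

lemma derived_generate_incl:
  assumes R: "R \<subseteq> carrier G" and N: "subgroup N G"
    and norm: "\<And>h n. h \<in> generate G R \<Longrightarrow> n \<in> N \<Longrightarrow> h \<otimes> n \<otimes> inv h \<in> N"
    and comm: "\<And>r s. r \<in> R \<Longrightarrow> s \<in> R \<Longrightarrow> r \<otimes> s \<otimes> inv r \<otimes> inv s \<in> N"
  shows "derived G (generate G R) \<subseteq> N"
proof -
  let ?L = "generate G R"
  let ?Z = "\<lambda>s. {h \<in> ?L. h \<otimes> s \<otimes> inv h \<otimes> inv s \<in> N}"
  have L: "subgroup ?L G" by (rule generate_is_subgroup[OF R])
  have car: "x \<in> ?L \<Longrightarrow> x \<in> carrier G" for x using generate_in_carrier[OF R] by auto
  have swap: "s \<otimes> h \<otimes> inv s \<otimes> inv h \<in> N"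
    if "h \<otimes> s \<otimes> inv h \<otimes> inv s \<in> N" "h \<in> ?L" "s \<in> ?L" for h s
  proof -
    have "inv (h \<otimes> s \<otimes> inv h \<otimes> inv s) \<in> N" using that N by (simp add: subgroup.m_inv_closed)
    then show ?thesis using that car by (simp add: m_assoc inv_mult_group)
  qed
  have Z: "subgroup (?Z s) G" if "s \<in> ?L" for s
    using subgroup_commuting_modulo[OF N L that norm] by blast
  have 1: "h \<otimes> s \<otimes> inv h \<otimes> inv s \<in> N" if "h \<in> ?L" "s \<in> R" for h s
  proof -
    have "R \<subseteq> ?Z s" using comm that by (auto intro: generate.incl)
    then show ?thesis
      using generate_subgroup_incl[OF _ Z, of R s] that by (auto intro: generate.incl)
  qed
  have 2: "h \<otimes> s \<otimes> inv h \<otimes> inv s \<in> N" if "h \<in> ?L" "s \<in> ?L" for h s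
  proof -
    have "R \<subseteq> ?Z h" using 1[OF that(1)] swap[OF _ that(1)] by (auto intro: generate.incl)
    then have "s \<in> ?Z h" using generate_subgroup_incl[OF _ Z, of R h] that by auto
    then show ?thesis using swap that by auto
  qed
  show ?thesis unfolding derived_def
    by (rule generate_subgroup_incl[OF _ N]) (use 2 in auto)
qed

text \<open>The hypothesis \<open>least\<close> serves twice: a normal subgroup of \<open>G\<close>
  is in particular normalised by \<open>D\<close>, which gives the monolith, and so is a normal
  subgroup of \<open>D\<close>, which gives simplicity.\<close>

lemma almost_simple_monolithI:
  assumes D: "D \<lhd> G" and ab: "a \<in> D" "b \<in> D" "a \<otimes> b \<noteq> b \<otimes> a"
    and least: "\<And>N. subgroup N G \<Longrightarrow> N \<noteq> {\<one>} \<Longrightarrow>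
                  (\<And>d n. d \<in> D \<Longrightarrow> n \<in> N \<Longrightarrow> d \<otimes> n \<otimes> inv d \<in> N) \<Longrightarrow> D \<subseteq> N"
  shows "monolith G = D" and "almost_simple G"
proof -
  have sub: "subgroup D G" using D by (rule normal_imp_subgroup)
  have carD: "x \<in> D \<Longrightarrow> x \<in> carrier G" for x using sub subgroup.mem_carrier by metis
  have nontriv: "D \<noteq> {\<one>}" using ab by auto
  show mono: "monolith G = D"
  proof
    show "monolith G \<subseteq> D" using D nontriv by (auto simp: monolith_def)
    have "D \<subseteq> N" if "N \<lhd> G" "N \<noteq> {\<one>}" for N
      using that by (intro least) (auto simp: normal_inv_iff carD)
    then show "D \<subseteq> monolith G" using carD by (auto simp: monolith_def)
  qed
  interpret D: group "G\<lparr>carrier := D\<rparr>" using sub by (rule subgroup_imp_group)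
  have "N = {\<one>} \<or> N = D" if N: "N \<lhd> G\<lparr>carrier := D\<rparr>" for N
  proof -
    have NDs: "subgroup N (G\<lparr>carrier := D\<rparr>)" using N by (rule Coset.normal_imp_subgroup)
    have ND: "N \<subseteq> D" using subgroup.subset[OF NDs] by simp
    have "subgroup N G" using incl_subgroup[OF sub NDs] .
    moreover have "d \<otimes> n \<otimes> inv d \<in> N" if "d \<in> D" "n \<in> N" for d n
      using N that sub by (simp add: D.normal_inv_iff)
    ultimately show ?thesis using least[of N] ND by auto
  qed
  then have "is_simple (G\<lparr>carrier := D\<rparr>)"
    using nontriv D.is_group by (simp add: is_simple_def)
  moreover have "\<not> comm_group (G\<lparr>carrier := D\<rparr>)"
    using ab comm_monoid.m_comm[of "G\<lparr>carrier := D\<rparr>" a b] by (auto simp: comm_group_def)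
  ultimately show "almost_simple G"
    unfolding almost_simple_def mono using is_group by simp
qed

end

section \<open>Groups of homeomorphisms\<close>

abbreviation finv :: "('a \<Rightarrow> 'b) \<Rightarrow> 'b \<Rightarrow> 'a" where
  "finv f \<equiv> inv_into UNIV f"

lemma homeo_group_simps [simp]:
  "f \<otimes>\<^bsub>homeo_group\<^esub> g = f \<circ> g" "\<one>\<^bsub>homeo_group\<^esub> = id"
  by (simp_all add: homeo_group_def)

lemma carrier_homeo_group:
  "f \<in> carrier homeo_group \<longleftrightarrow> bij f \<and> continuous_on UNIV f \<and> continuous_on UNIV (finv f)"
proof
  assume "f \<in> carrier homeo_group"
  then obtain g where g: "homeomorphism UNIV UNIV f g" by (auto simp: homeo_group_def)
  then have "f \<circ> g = id" "g \<circ> f = id" by (auto simp: homeomorphism_def fun_eq_iff)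
  then have "bij f" "finv f = g" by (auto intro: o_bij inv_unique_comp)
  then show "bij f \<and> continuous_on UNIV f \<and> continuous_on UNIV (finv f)"
    using g by (auto simp: homeomorphism_def)
next
  assume f: "bij f \<and> continuous_on UNIV f \<and> continuous_on UNIV (finv f)"
  then have "homeomorphism UNIV UNIV f (finv f)"
    by (auto simp: homeomorphism_def bij_is_inj bij_is_surj surj_f_inv_f bij_imp_bij_inv)
  then show "f \<in> carrier homeo_group" by (auto simp: homeo_group_def)
qed

lemma group_homeo_group: "group homeo_group"
proof (rule groupI)
  fix f :: "'a \<Rightarrow> 'a" assume f: "f \<in> carrier homeo_group"
  then have "finv f \<in> carrier homeo_group" "finv f \<circ> f = id"
    by (auto simp: carrier_homeo_group bij_imp_bij_inv inv_inv_eq bij_is_inj)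
  then show "\<exists>y\<in>carrier homeo_group. y \<otimes>\<^bsub>homeo_group\<^esub> f = \<one>\<^bsub>homeo_group\<^esub>"
    by auto
next
  fix f g :: "'a \<Rightarrow> 'a" assume "f \<in> carrier homeo_group" "g \<in> carrier homeo_group"
  then show "f \<otimes>\<^bsub>homeo_group\<^esub> g \<in> carrier homeo_group"
    by (auto simp: carrier_homeo_group bij_comp o_inv_distrib simp del: o_apply
        intro!: continuous_on_compose intro: continuous_on_subset)
qed (auto simp: carrier_homeo_group o_assoc)

interpretation homeo: group "homeo_group :: ('a::topological_space \<Rightarrow> 'a) monoid"
  by (rule group_homeo_group)

lemma m_inv_homeo_group:
  assumes "f \<in> carrier homeo_group"
  shows "inv\<^bsub>homeo_group\<^esub> f = finv f"
  using assms
  by (intro homeo.inv_equality) (auto simp: carrier_homeo_group bij_imp_bij_inv inv_inv_eq bij_is_inj)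

lemma homeo_subgroupD:
  assumes "subgroup L homeo_group"
  shows "f \<in> L \<Longrightarrow> f \<in> carrier homeo_group" and "id \<in> L"
    and "f \<in> L \<Longrightarrow> g \<in> L \<Longrightarrow> f \<circ> g \<in> L" and "f \<in> L \<Longrightarrow> finv f \<in> L"
proof -
  show car: "f \<in> L \<Longrightarrow> f \<in> carrier homeo_group" using subgroup.mem_carrier[OF assms] .
  show "id \<in> L" using subgroup.one_closed[OF assms] by simp
  show "f \<in> L \<Longrightarrow> g \<in> L \<Longrightarrow> f \<circ> g \<in> L" using subgroup.m_closed[OF assms, of f g] by simp
  show "f \<in> L \<Longrightarrow> finv f \<in> L"
    using subgroup.m_inv_closed[OF assms, of f] m_inv_homeo_group[OF car] by simp
qed

lemma homeo_subgroupI: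
  assumes "L \<subseteq> carrier homeo_group" "id \<in> L"
    and "\<And>f g. f \<in> L \<Longrightarrow> g \<in> L \<Longrightarrow> f \<circ> g \<in> L" and "\<And>f. f \<in> L \<Longrightarrow> finv f \<in> L"
  shows "subgroup L homeo_group"
proof (rule subgroup.intro)
  show "inv\<^bsub>homeo_group\<^esub> f \<in> L" if "f \<in> L" for f
    using assms(1,4) that m_inv_homeo_group by (metis subsetD)
qed (use assms in auto)

lemma homeo_image:
  assumes "f \<in> carrier homeo_group"
  shows "open U \<Longrightarrow> open (f ` U)" and "closed U \<Longrightarrow> closed (f ` U)"
proof -
  have f: "bij f" "continuous_on UNIV (finv f)" using assms by (auto simp: carrier_homeo_group)
  then have "f ` U = finv f -` U" by (simp add: bij_image_Collect_eq bij_vimage_eq_inv_image inv_inv_eq bij_imp_bij_inv)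
  then show "open U \<Longrightarrow> open (f ` U)" "closed U \<Longrightarrow> closed (f ` U)"
    using f by (auto simp: open_vimage closed_vimage)
qed

lemma homeo_apply:
  assumes "f \<in> carrier homeo_group"
  shows "finv f (f x) = x" "f (finv f x) = x" "f x = f y \<longleftrightarrow> x = y"
  using assms by (auto simp: carrier_homeo_group bij_is_inj bij_is_surj surj_f_inv_f inj_eq)

section \<open>Piecewise full groups\<close>

text \<open>The cover can be replaced by a condition at each point: conversely, all open sets on
  which \<open>\<phi>\<close> agrees with one element of \<open>K\<close> form a cover.\<close>

lemma piecewise_full_iff:
  "\<phi> \<in> piecewise_full K \<longleftrightarrow> \<phi> \<in> carrier homeo_group \<and>
     (\<forall>x. \<exists>U g. open U \<and> x \<in> U \<and> g \<in> K \<and> (\<forall>y\<in>U. \<phi> y = g y))" (is "?L \<longleftrightarrow> ?R")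
proof
  assume ?L
  then show ?R unfolding piecewise_full_def by simp (metis UNIV_I UnionE)
next
  assume R: ?R
  let ?O = "{U. open U \<and> (\<exists>g\<in>K. \<forall>x\<in>U. \<phi> x = g x)}"
  have "\<Union>?O = UNIV" using R by blast
  then show ?L using R unfolding piecewise_full_def by (auto intro!: exI[of _ ?O])
qed

lemma piecewise_fullE:
  assumes "\<phi> \<in> piecewise_full K"
  obtains U g where "open U" "x \<in> U" "g \<in> K" "\<forall>y\<in>U. \<phi> y = g y"
  using assms unfolding piecewise_full_iff by blast

lemma subgroup_piecewise_full:
  fixes K :: "('a::topological_space \<Rightarrow> 'a) set"
  assumes K: "subgroup K homeo_group"
  shows "subgroup (piecewise_full K) homeo_group"
proof (rule homeo_subgroupI)
  show "piecewise_full K \<subseteq> carrier homeo_group" by (auto simp: piecewise_full_def)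
  have "(id :: 'a \<Rightarrow> 'a) \<in> K" using homeo_subgroupD(2)[OF K] .
  moreover from this have "(id :: 'a \<Rightarrow> 'a) \<in> carrier homeo_group" by (rule homeo_subgroupD(1)[OF K])
  ultimately show "id \<in> piecewise_full K"
    unfolding piecewise_full_iff by (intro conjI allI exI[of _ UNIV] exI[of _ id]) auto
next
  fix f g assume f: "f \<in> piecewise_full K" and g: "g \<in> piecewise_full K"
  have car: "f \<in> carrier homeo_group" "g \<in> carrier homeo_group"
    using f g by (auto simp: piecewise_full_iff)
  show "f \<circ> g \<in> piecewise_full K"
    unfolding piecewise_full_iff
  proof (intro conjI allI)
    show "f \<circ> g \<in> carrier homeo_group" using car homeo.m_closed[of f g] by simp
    fix x
    obtain U k where U: "open U" "x \<in> U" "k \<in> K" "\<forall>y\<in>U. g y = k y"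
      using g by (rule piecewise_fullE)
    obtain V l where V: "open V" "g x \<in> V" "l \<in> K" "\<forall>y\<in>V. f y = l y"
      using f by (rule piecewise_fullE)
    have "open (g -` V \<inter> U)" using car(2) U V by (auto simp: carrier_homeo_group open_vimage)
    then show "\<exists>U h. open U \<and> x \<in> U \<and> h \<in> K \<and> (\<forall>y\<in>U. (f \<circ> g) y = h y)"
      using U V homeo_subgroupD(3)[OF K, of l k]
      by (intro exI[of _ "g -` V \<inter> U"] exI[of _ "l \<circ> k"]) auto
  qed
next
  fix f assume f: "f \<in> piecewise_full K"
  have car: "f \<in> carrier homeo_group" using f by (auto simp: piecewise_full_iff)
  show "finv f \<in> piecewise_full K"
    unfolding piecewise_full_iff
  proof (intro conjI allI)
    show "finv f \<in> carrier homeo_group" by (rule homeo_subgroupD(4)[OF homeo.subgroup_self car])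
    fix x
    obtain U k where U: "open U" "finv f x \<in> U" "k \<in> K" "\<forall>y\<in>U. f y = k y"
      using f by (rule piecewise_fullE)
    have k: "k \<in> carrier homeo_group" using homeo_subgroupD(1)[OF K] U by auto
    have "x \<in> f ` U" by (rule image_eqI[OF _ U(2)]) (simp add: homeo_apply(2)[OF car])
    moreover have "finv f y = finv k y" if y: "y \<in> f ` U" for y
    proof -
      obtain u where "y = f u" "u \<in> U" using y by blast
      then show ?thesis using U(4) homeo_apply(1)[OF k, of u] homeo_apply(1)[OF car, of u] by simp
    qed
    ultimately show "\<exists>U h. open U \<and> x \<in> U \<and> h \<in> K \<and> (\<forall>y\<in>U. finv f y = h y)"
      using U homeo_image(1)[OF car, of U] homeo_subgroupD(4)[OF K, of k] by blast
  qed
qed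

text \<open>This is what lets the later locale forget \<open>K\<close> and assume only that
  \<open>G\<close> is closed under \<open>piecewise_full\<close>.\<close>

lemma piecewise_full_idem: "piecewise_full (piecewise_full K) \<subseteq> piecewise_full K"
proof
  fix f assume f: "f \<in> piecewise_full (piecewise_full K)"
  have "\<exists>U g. open U \<and> x \<in> U \<and> g \<in> K \<and> (\<forall>y\<in>U. f y = g y)" for x
  proof -
    obtain U k where U: "open U" "x \<in> U" "k \<in> piecewise_full K" "\<forall>y\<in>U. f y = k y"
      using f by (rule piecewise_fullE)
    obtain V l where V: "open V" "x \<in> V" "l \<in> K" "\<forall>y\<in>V. k y = l y"
      using U(3) by (rule piecewise_fullE)
    show ?thesis using U V by (intro exI[of _ "U \<inter> V"] exI[of _ l]) auto
  qed
  then show "f \<in> piecewise_full K"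
    using f unfolding piecewise_full_iff by blast
qed

text \<open>An involution once \<open>A\<close> is disjoint from its image; otherwise the first
  branch wins on the overlap and the map need not be injective.\<close>

definition exchange :: "('a \<Rightarrow> 'a) \<Rightarrow> 'a set \<Rightarrow> 'a \<Rightarrow> 'a" where
  "exchange g A x = (if x \<in> A then g x else if x \<in> g ` A then finv g x else x)"

section \<open>Commutators and supports of homeomorphisms\<close>

definition commutator :: "('a \<Rightarrow> 'a) \<Rightarrow> ('a \<Rightarrow> 'a) \<Rightarrow> 'a \<Rightarrow> 'a" where
  "commutator f g = f \<circ> g \<circ> finv f \<circ> finv g"

lemma commutator_eq_homeo_group:
  assumes "f \<in> carrier homeo_group" "g \<in> carrier homeo_group"
  shows "f \<otimes>\<^bsub>homeo_group\<^esub> g \<otimes>\<^bsub>homeo_group\<^esub> inv\<^bsub>homeo_group\<^esub> f \<otimes>\<^bsub>homeo_group\<^esub> inv\<^bsub>homeo_group\<^esub> g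
    = commutator f g"
  using assms by (simp add: commutator_def m_inv_homeo_group)

lemma commutator_in_derived:
  assumes "L \<subseteq> carrier homeo_group" "f \<in> L" "g \<in> L"
  shows "commutator f g \<in> derived homeo_group L"
proof -
  have "commutator f g = f \<otimes>\<^bsub>homeo_group\<^esub> g \<otimes>\<^bsub>homeo_group\<^esub> inv\<^bsub>homeo_group\<^esub> f
      \<otimes>\<^bsub>homeo_group\<^esub> inv\<^bsub>homeo_group\<^esub> g"
    using assms by (intro commutator_eq_homeo_group[symmetric]) auto
  then show ?thesis unfolding derived_def using assms(2,3) by (intro generate.incl) blast
qed

lemma rist_inv:
  assumes "L \<subseteq> carrier homeo_group" "f \<in> rist L A" "x \<notin> A"
  shows "finv f x = x"
proof -
  have f: "f \<in> carrier homeo_group" "f x = x" using assms by (auto simp: rist_def)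
  show ?thesis using homeo_apply(1)[OF f(1), of x] f(2) by simp
qed

lemma rist_maps:
  assumes "L \<subseteq> carrier homeo_group" "f \<in> rist L A" "x \<in> A"
  shows "f x \<in> A" and "finv f x \<in> A"
proof -
  have f: "f \<in> carrier homeo_group" using assms by (auto simp: rist_def)
  have fix_out: "f y = y" if "y \<notin> A" for y using assms(2) that by (simp add: rist_def)
  show "f x \<in> A"
  proof (rule ccontr)
    assume "f x \<notin> A"
    then have "f (f x) = f x" by (rule fix_out)
    then show False using homeo_apply(3)[OF f] assms(3) \<open>f x \<notin> A\<close> by simp
  qed
  show "finv f x \<in> A"
  proof (rule ccontr)
    assume "finv f x \<notin> A"
    then have "f (finv f x) = finv f x" by (rule fix_out)
    then show False using homeo_apply(2)[OF f, of x] assms(3) \<open>finv f x \<notin> A\<close> by simp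
  qed
qed

text \<open>Since \<open>n\<close> moves \<open>A\<close> off itself, \<open>[f, n]\<close> acts on \<open>A\<close> as \<open>f\<close> does, so \<open>[[f, n], h] = [f, h]\<close>.\<close>

lemma commutator_rist_mem:
  assumes N: "subgroup N homeo_group" and L: "L \<subseteq> carrier homeo_group"
    and norm: "\<And>l n. l \<in> L \<Longrightarrow> n \<in> N \<Longrightarrow> l \<circ> n \<circ> finv l \<in> N"
    and n: "n \<in> N" "n ` A \<inter> A = {}"
    and f: "f \<in> rist L A" and h: "h \<in> rist L A"
  shows "commutator f h \<in> N"
proof -
  define f' where "f' = n \<circ> finv f \<circ> finv n"
  have fL: "f \<in> L" "h \<in> L" using f h by (auto simp: rist_def)
  have fc: "f \<in> carrier homeo_group" "h \<in> carrier homeo_group" using fL L by auto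
  have nc: "n \<in> carrier homeo_group" using homeo_subgroupD(1)[OF N n(1)] .
  define u where "u = f \<circ> f'"
  have "(f \<circ> n \<circ> finv f) \<circ> finv n \<in> N"
    by (intro homeo_subgroupD[OF N] norm n fL)
  then have u: "u \<in> N" by (simp add: u_def f'_def o_assoc)
  have uc: "u \<in> carrier homeo_group" using homeo_subgroupD(1)[OF N u] .
  have "u \<circ> (h \<circ> finv u \<circ> finv h) \<in> N"
    by (intro homeo_subgroupD(3,4)[OF N] norm u fL)
  moreover have "u \<circ> (h \<circ> finv u \<circ> finv h) = commutator f h"
  proof
    have f'A: "f' x = x" if "x \<in> A" for x
    proof -
      have "n (finv n x) = x" by (rule homeo_apply(2)[OF nc])
      then have "finv n x \<notin> A" using that n(2) by (metis disjoint_iff imageI)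
      then show ?thesis
        using rist_inv[OF L f] homeo_apply(2)[OF nc] by (simp add: f'_def)
    qed
    have uA: "u x = f x" if "x \<in> A" for x using f'A that by (simp add: u_def)
    have uiA: "finv u x = finv f x" if "x \<in> A" for x
    proof -
      have "u (finv f x) = x"
        using uA[OF rist_maps(2)[OF L f that]] homeo_apply(2)[OF fc(1)] by simp
      then show ?thesis using homeo_apply(1)[OF uc, of "finv f x"] by simp
    qed
    \<comment> \<open>As \<open>u\<close> preserves the complement of \<open>A\<close>, where
      \<open>h\<close> is trivial, both commutators are trivial there.\<close>
    have ui_out: "finv u x \<notin> A" if "x \<notin> A" for x
    proof
      assume "finv u x \<in> A"
      then have "u (finv u x) \<in> A" using uA rist_maps(1)[OF L f] by simp
      then show False using homeo_apply(2)[OF uc, of x] that by simp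
    qed
    fix x
    show "(u \<circ> (h \<circ> finv u \<circ> finv h)) x = commutator f h x"
    proof (cases "x \<in> A")
      case True
      then show ?thesis
        using uA uiA rist_maps[OF L f] rist_maps[OF L h] by (simp add: commutator_def)
    next
      case False
      have "h (finv u x) = finv u x" "h x = x" "f x = x"
        using ui_out[OF False] False h f by (auto simp: rist_def)
      then show ?thesis
        using rist_inv[OF L f False] rist_inv[OF L h False] homeo_apply(2)[OF uc, of x]
        by (simp add: commutator_def)
    qed
  qed
  ultimately show ?thesis by simp
qed

lemma zero_dimensional_clopen:
  fixes x :: "'a::topological_space"
  assumes "zero_dimensional TYPE('a)" "open U" "x \<in> U"
  obtains V where "open V" "closed V" "x \<in> V" "V \<subseteq> U"
proof -
  obtain B :: "'a set set" where B: "topological_basis B" "\<forall>V\<in>B. open V \<and> closed V"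
    using assms unfolding zero_dimensional_def by blast
  obtain V where "V \<in> B" "x \<in> V" "V \<subseteq> U" using topological_basisE[OF B(1) assms(2,3)] .
  then show ?thesis using that B(2) by blast
qed

locale piecewise_full_group =
  fixes G :: "('a::t2_space \<Rightarrow> 'a) set"
  assumes subgroup_G: "subgroup G homeo_group"
    and full: "piecewise_full G \<subseteq> G"
    and zero_dim: "zero_dimensional TYPE('a)"
begin

lemmas G_carrier = homeo_subgroupD(1)[OF subgroup_G]
lemmas G_id = homeo_subgroupD(2)[OF subgroup_G]
lemmas G_comp = homeo_subgroupD(3)[OF subgroup_G]
lemmas G_inv = homeo_subgroupD(4)[OF subgroup_G]
lemmas G_apply = homeo_apply[OF G_carrier]
lemmas G_image = homeo_image[OF G_carrier]
lemmas clopen_nbhd = zero_dimensional_clopen[OF zero_dim]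

lemma G_continuous: "g \<in> G \<Longrightarrow> continuous_on UNIV g"
  using G_carrier by (auto simp: carrier_homeo_group)

lemma G_subset: "G \<subseteq> carrier homeo_group"
  using G_carrier by auto

text \<open>An involution is its own inverse, so continuity has to be checked in one direction only,
  and it is a local property inherited from the elements of \<open>G\<close>.\<close>

lemma involution_mem:
  assumes inv: "\<And>x. \<phi> (\<phi> x) = x"
    and loc: "\<And>x. \<exists>U g. open U \<and> x \<in> U \<and> g \<in> G \<and> (\<forall>y\<in>U. \<phi> y = g y)"
  shows "\<phi> \<in> G"
proof -
  have "\<phi> \<circ> \<phi> = id" using inv by auto
  then have "bij \<phi>" "finv \<phi> = \<phi>" by (auto intro: o_bij inv_unique_comp)
  moreover have "continuous_on UNIV \<phi>"
  proof (subst continuous_on_eq_continuous_at, simp, intro ballI)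
    fix x
    obtain U g where U: "open U" "x \<in> U" "g \<in> G" "\<forall>y\<in>U. \<phi> y = g y" using loc by blast
    then have "\<forall>\<^sub>F y in nhds x. \<phi> y = g y" by (auto simp: eventually_nhds)
    moreover have "isCont g x"
      using G_continuous[OF U(3)] by (simp add: continuous_on_eq_continuous_at)
    ultimately show "isCont \<phi> x" using isCont_cong by metis
  qed
  ultimately have "\<phi> \<in> piecewise_full G"
    using loc by (simp add: piecewise_full_iff carrier_homeo_group)
  then show ?thesis using full by auto
qed

text \<open>Since \<open>A\<close> is clopen, \<open>A\<close>, its image and the complement of both
  form an open cover, on whose members the map is \<open>g\<close>, \<open>finv g\<close> and
  \<open>id\<close>.\<close>

lemma exchange_mem:
  assumes g: "g \<in> G" and A: "open A" "closed A" "g ` A \<inter> A = {}"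
  shows "exchange g A \<in> G"
proof (rule involution_mem)
  show "exchange g A (exchange g A x) = x" for x
    using A G_apply[OF g] unfolding exchange_def by auto
next
  fix x
  consider "x \<in> A" | "x \<in> g ` A" | "x \<in> - (A \<union> g ` A)" by auto
  then show "\<exists>U h. open U \<and> x \<in> U \<and> h \<in> G \<and> (\<forall>y\<in>U. exchange g A y = h y)"
  proof cases
    case 1
    then show ?thesis using A g by (intro exI[of _ A] exI[of _ g]) (auto simp: exchange_def)
  next
    case 2
    then show ?thesis using A g G_image G_inv
      by (intro exI[of _ "g ` A"] exI[of _ "finv g"]) (auto simp: exchange_def)
  next
    case 3
    have "open (- (A \<union> g ` A))"
      using A(2) G_image(2)[OF g A(2)] by (intro open_Compl closed_Un)
    then show ?thesis using 3 G_id
      by (intro exI[of _ "- (A \<union> g ` A)"] exI[of _ id]) (auto simp: exchange_def)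
  qed
qed

lemma moved_clopen:
  assumes g: "g \<in> G" and x: "g x \<noteq> x" and U: "open U" "x \<in> U"
  obtains A where "open A" "closed A" "x \<in> A" "A \<subseteq> U" "g ` A \<inter> A = {}"
proof -
  obtain V W where VW: "open V" "open W" "x \<in> V" "g x \<in> W" "V \<inter> W = {}"
    using hausdorff[OF x[symmetric]] by blast
  have "open (U \<inter> V \<inter> g -` W)"
    using VW U G_continuous[OF g] by (auto simp: open_vimage)
  moreover have "x \<in> U \<inter> V \<inter> g -` W" using VW U by simp
  ultimately obtain A where A: "open A" "closed A" "x \<in> A" "A \<subseteq> U \<inter> V \<inter> g -` W"
    by (rule clopen_nbhd)
  then show ?thesis using that[of A] VW by blast
qed

lemma ex_moved_point:
  assumes "N \<noteq> {id}" "N \<subseteq> G" "id \<in> N"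
  obtains n x where "n \<in> N" "n x \<noteq> x"
proof -
  obtain n where "n \<in> N" "n \<noteq> id" using assms by blast
  then show ?thesis using that by (auto simp: fun_eq_iff)
qed

abbreviation cc :: "'a set \<Rightarrow> bool" where
  "cc Y \<equiv> open Y \<and> closed Y \<and> compressible_set G Y"

lemma compressible_subset: "compressible_set G Y \<Longrightarrow> Z \<subseteq> Y \<Longrightarrow> compressible_set G Z"
  unfolding compressible_set_def by (meson image_mono subset_trans)

lemma compressible_image:
  assumes "compressible_set G Y" "g \<in> G"
  shows "compressible_set G (g ` Y)"
  unfolding compressible_set_def
proof (intro allI impI)
  fix U :: "'a set" assume "open U \<and> U \<noteq> {}"
  then obtain h where "h \<in> G" "h ` Y \<subseteq> U" using assms unfolding compressible_set_def by blast
  then have "h \<circ> finv g \<in> G" "(h \<circ> finv g) ` g ` Y \<subseteq> U"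
    using assms G_comp G_inv G_apply by auto
  then show "\<exists>k\<in>G. k ` g ` Y \<subseteq> U" by blast
qed

lemma cc_image: "cc Y \<Longrightarrow> g \<in> G \<Longrightarrow> cc (g ` Y)"
  using compressible_image G_image by auto

lemma compressibleD:
  "compressible_set G Y \<Longrightarrow> open U \<Longrightarrow> U \<noteq> {} \<Longrightarrow> \<exists>g\<in>G. g ` Y \<subseteq> U"
  unfolding compressible_set_def by blast

end

section \<open>Rigid stabilisers\<close>

context piecewise_full_group
begin

lemma rist_mono: "f \<in> rist L A \<Longrightarrow> A \<subseteq> B \<Longrightarrow> f \<in> rist L B"
  by (auto simp: rist_def)

lemma exchange_rist:
  assumes "g \<in> G" "open A" "closed A" "g ` A \<inter> A = {}" "A \<union> g ` A \<subseteq> Y"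
  shows "exchange g A \<in> rist G Y"
  using exchange_mem[OF assms(1-4)] assms(5) by (auto simp: rist_def exchange_def)

lemma rist_conj:
  assumes g: "g \<in> G" and f: "f \<in> rist G Y"
  shows "g \<circ> f \<circ> finv g \<in> rist G (g ` Y)"
proof -
  have "g \<circ> f \<circ> finv g \<in> G" using g f by (intro G_comp G_inv) (auto simp: rist_def)
  moreover have "(g \<circ> f \<circ> finv g) x = x" if "x \<notin> g ` Y" for x
  proof -
    have x: "g (finv g x) = x" by (rule G_apply(2)[OF g])
    then have "finv g x \<notin> Y" using that by (metis imageI)
    then show ?thesis using f x by (simp add: rist_def)
  qed
  ultimately show ?thesis by (simp add: rist_def)
qed

text \<open>The conjugate of a map supported in \<open>C\<close> depends only on the restriction of
  the conjugating element to \<open>C\<close>. This later trades elements of \<open>G\<close> for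
  elements of \<open>D\<close>.\<close>

lemma rist_conj_eq:
  assumes c: "c \<in> rist G C" and g: "g \<in> G" and d: "d \<in> G" and eq: "\<And>x. x \<in> C \<Longrightarrow> d x = g x"
  shows "g \<circ> c \<circ> finv g = d \<circ> c \<circ> finv d"
proof
  fix x
  show "(g \<circ> c \<circ> finv g) x = (d \<circ> c \<circ> finv d) x"
  proof (cases "x \<in> g ` C")
    case True
    then obtain y where y: "y \<in> C" "x = g y" "x = d y" using eq by auto
    then have "finv g x = y" "finv d x = y" using G_apply(1)[OF g, of y] G_apply(1)[OF d, of y] by auto
    then show ?thesis using eq rist_maps(1)[OF G_subset c y(1)] by simp
  next
    case False
    have "finv g x \<notin> C" using False G_apply(2)[OF g, of x] by (metis imageI)
    moreover have "finv d x \<notin> C" using False G_apply(2)[OF d, of x] eq by (metis imageI)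
    ultimately show ?thesis using c G_apply(2)[OF g, of x] G_apply(2)[OF d, of x] by (simp add: rist_def)
  qed
qed

lemma commutator_mem: "f \<in> G \<Longrightarrow> h \<in> G \<Longrightarrow> commutator f h \<in> G"
  by (simp add: commutator_def G_comp G_inv)

lemma commutator_rist:
  assumes "f \<in> rist G A" "h \<in> rist G A"
  shows "commutator f h \<in> rist G A"
proof -
  have "f \<in> G" "h \<in> G" using assms by (auto simp: rist_def)
  moreover have "commutator f h x = x" if "x \<notin> A" for x
    using that assms rist_inv[OF G_subset assms(1) that] rist_inv[OF G_subset assms(2) that]
    by (simp add: commutator_def rist_def)
  ultimately show ?thesis by (simp add: rist_def commutator_mem)
qed

lemma commutator_neq_id:
  assumes f: "f \<in> G" "f ` A \<inter> A = {}" and h: "h \<in> rist G A" "h y \<noteq> y"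
  shows "f \<circ> h \<noteq> h \<circ> f" and "commutator f h \<noteq> id"
proof -
  have y: "y \<in> A" and hG: "h \<in> G" using h by (auto simp: rist_def)
  then have "f y \<notin> A" using f(2) by blast
  then have "h (f y) = f y" using h by (simp add: rist_def)
  moreover have "f (h y) \<noteq> f y" using h(2) G_apply(3)[OF f(1)] by simp
  ultimately have neq: "f (h y) \<noteq> h (f y)" by simp
  then show "f \<circ> h \<noteq> h \<circ> f" by (metis comp_apply)
  \<comment> \<open>The point h(f(y)) is chosen so that the two inverses in the commutator
    cancel.\<close>
  have "commutator f h (h (f y)) = f (h y)"
    using G_apply(1)[OF f(1)] G_apply(1)[OF hG] by (simp add: commutator_def)
  then show "commutator f h \<noteq> id" using neq by auto
qed

end

section \<open>Compressible clopen sets\<close>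

locale compressible_full_group = piecewise_full_group +
  assumes compressible: "compressible_action G"
begin

text \<open>A clopen neighbourhood inside the given compressible open set is still compressible, and
  some element of \<open>G\<close> carries it into \<open>U\<close>.\<close>

lemma ex_cc:
  assumes "open U" "U \<noteq> {}"
  obtains Y where "cc Y" "Y \<noteq> {}" "Y \<subseteq> U"
proof -
  obtain Y0 where Y0: "open Y0" "Y0 \<noteq> {}" "compressible_set G Y0"
    using compressible by (auto simp: compressible_action_def)
  then obtain y where y: "y \<in> Y0" by blast
  obtain Y where Y: "open Y" "closed Y" "y \<in> Y" "Y \<subseteq> Y0" using clopen_nbhd[OF Y0(1) y] .
  then have cY: "cc Y" using compressible_subset Y0(3) by blast
  then obtain g where g: "g \<in> G" "g ` Y \<subseteq> U" using compressibleD[of Y U] cY assms by blast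
  show ?thesis using that[of "g ` Y"] cc_image[OF cY g(1)] g Y by blast
qed

end

section \<open>Compressible sets in spaces without isolated points\<close>

locale perfect_compressible = compressible_full_group +
  assumes perfect: "\<And>x :: 'a. \<not> open {x}"
begin

definition H :: "('a \<Rightarrow> 'a) set" where
  "H = generate homeo_group (\<Union>{rist G Y |Y. cc Y})"

definition D :: "('a \<Rightarrow> 'a) set" where
  "D = derived homeo_group H"

text \<open>A non-empty open set inside a finite set would be finite, and deleting all but one of
  its points, a closed set, would leave an isolated point.\<close>

lemma clopen_avoiding:
  fixes U :: "'a set"
  assumes U: "open U" "U \<noteq> {}" and F: "finite F"
  obtains V where "open V" "closed V" "V \<noteq> {}" "V \<subseteq> U" "V \<inter> F = {}"
proof -
  have "\<not> U \<subseteq> F"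
  proof
    assume "U \<subseteq> F"
    then have "finite U" using F finite_subset by blast
    obtain x where x: "x \<in> U" using U by blast
    then have "{x} = U - (U - {x})" by blast
    moreover have "open (U - (U - {x}))"
      using U(1) \<open>finite U\<close> by (intro open_Diff finite_imp_closed finite_Diff)
    ultimately have "open {x}" by simp
    then show False using perfect by blast
  qed
  then obtain x where x: "x \<in> U - F" by blast
  have "open (U - F)" using U F by (intro open_Diff finite_imp_closed)
  then obtain V where "open V" "closed V" "x \<in> V" "V \<subseteq> U - F" using clopen_nbhd x by blast
  then show ?thesis using that by blast
qed

lemma avoiding:
  fixes U :: "'a set"
  assumes "open U" "U \<noteq> {}" "finite F"
  obtains x where "x \<in> U" "x \<notin> F"
proof -
  obtain V where "V \<noteq> {}" "V \<subseteq> U" "V \<inter> F = {}" using clopen_avoiding[OF assms] by metis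
  then show ?thesis using that by blast
qed

lemma split_open:
  fixes U :: "'a set"
  assumes U: "open U" "U \<noteq> {}"
  obtains V W where "open V" "open W" "V \<noteq> {}" "W \<noteq> {}" "V \<inter> W = {}" "V \<subseteq> U" "W \<subseteq> U"
proof -
  obtain x where x: "x \<in> U" using U by blast
  obtain V where V: "open V" "closed V" "V \<noteq> {}" "V \<subseteq> U" "V \<inter> {x} = {}"
    by (rule clopen_avoiding[OF U finite.insertI[OF finite.emptyI]])
  then show ?thesis using that[of V "U - V"] U x by auto
qed

lemma cc_neq_UNIV: "cc C \<Longrightarrow> C \<noteq> UNIV"
proof
  assume C: "cc C" "C = UNIV"
  \<comment> \<open>Here \<open>undefined\<close> is merely some point for \<open>V\<close> to miss;
    a bijection cannot carry the whole space into \<open>V\<close>.\<close>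
  obtain V :: "'a set" where V: "open V" "closed V" "V \<noteq> {}" "V \<subseteq> UNIV" "V \<inter> {undefined} = {}"
    by (rule clopen_avoiding[OF open_UNIV UNIV_not_empty finite.insertI[OF finite.emptyI]])
  obtain g where "g \<in> G" "g ` C \<subseteq> V" using compressibleD[of C V] C V by blast
  then have "g (finv g undefined) \<in> V" using C by auto
  then show False using G_apply(2)[OF \<open>g \<in> G\<close>] V(5) by simp
qed

text \<open>The exchange first moves \<open>A \<union> B\<close> into a compressible set inside its complement, because an
  exchange with a set that meets \<open>A \<union> B\<close> is not available.\<close>

lemma cc_Un:
  assumes A: "cc A" and B: "cc B" and AB: "A \<union> B \<noteq> UNIV"
  shows "cc (A \<union> B)"
proof -
  have "open (- (A \<union> B))" using A B by (intro open_Compl closed_Un) auto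
  moreover have "- (A \<union> B) \<noteq> {}" using AB by auto
  ultimately obtain P where P: "cc P" "P \<noteq> {}" "P \<subseteq> - (A \<union> B)" by (rule ex_cc)
  obtain P1 P2 where S: "open P1" "open P2" "P1 \<noteq> {}" "P2 \<noteq> {}" "P1 \<inter> P2 = {}" "P1 \<subseteq> P" "P2 \<subseteq> P"
    by (rule split_open[OF conjunct1[OF P(1)] P(2)])
  \<comment> \<open>With \<open>A\<close> removed, and with disjoint targets \<open>P1\<close> and
    \<open>P2\<close>, every point of \<open>A \<union> B\<close> is moved by exactly one of the two
    exchanges.\<close>
  define B' where "B' = B - A"
  have B': "cc B'" using A B compressible_subset[of B B'] by (auto simp: B'_def open_Diff closed_Diff)
  obtain g where g: "g \<in> G" "g ` A \<subseteq> P1" using compressibleD[of A P1] A S by blast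
  obtain h where h: "h \<in> G" "h ` B' \<subseteq> P2" using compressibleD[of B' P2] B' S by blast
  define \<phi> where "\<phi> = exchange g A \<circ> exchange h B'"
  have "g ` A \<inter> A = {}" "h ` B' \<inter> B' = {}" using g(2) h(2) S P unfolding B'_def by blast+
  then have \<phi>: "\<phi> \<in> G" unfolding \<phi>_def using A B' g(1) h(1) by (intro G_comp exchange_mem) auto
  have "\<phi> x \<in> P" if x: "x \<in> A \<union> B" for x
  proof (cases "x \<in> A")
    case True
    then have "x \<notin> B'" "x \<notin> h ` B'" using h(2) S P unfolding B'_def by blast+
    then have "\<phi> x = g x" using True by (simp add: \<phi>_def exchange_def)
    then show ?thesis using True g(2) S by blast
  next
    case False
    then have "x \<in> B'" using x by (simp add: B'_def)
    then have hx: "h x \<in> P2" "exchange h B' x = h x" using h(2) by (auto simp: exchange_def)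
    then have "h x \<notin> A" "h x \<notin> g ` A" using g(2) S P by blast+
    then have "\<phi> x = h x" using hx by (simp add: \<phi>_def exchange_def)
    then show ?thesis using hx S by auto
  qed
  \<comment> \<open>The union sits inside a translate of the compressible set
    \<open>P\<close>.\<close>
  then have "A \<union> B \<subseteq> finv \<phi> ` P" using G_apply(1)[OF \<phi>] by (metis image_eqI subsetI)
  then show ?thesis
    using compressible_subset[OF compressible_image[OF _ G_inv[OF \<phi>]], of P "A \<union> B"] P A B by auto
qed

section \<open>The subgroups \<open>H\<close> and \<open>D\<close>\<close>

lemma generators_subset: "\<Union>{rist G Y |Y. cc Y} \<subseteq> carrier homeo_group"
  using G_carrier by (auto simp: rist_def)

lemma subgroup_H: "subgroup H homeo_group"
  unfolding H_def by (rule homeo.generate_is_subgroup[OF generators_subset])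

lemma H_subset: "H \<subseteq> G"
  unfolding H_def by (rule homeo.generate_subgroup_incl[OF _ subgroup_G]) (auto simp: rist_def)

lemma H_carrier: "H \<subseteq> carrier homeo_group"
  using H_subset G_subset by auto

lemma subgroup_D: "subgroup D homeo_group"
  unfolding D_def by (rule homeo.derived_is_subgroup[OF H_carrier])

lemma D_subset_H: "D \<subseteq> H"
  unfolding D_def by (rule homeo.derived_incl[OF subset_refl subgroup_H])

lemma D_subset: "D \<subseteq> G"
  using D_subset_H H_subset by auto

lemma D_carrier: "D \<subseteq> carrier homeo_group"
  using D_subset G_subset by auto

lemma rist_in_H: "cc Y \<Longrightarrow> f \<in> rist G Y \<Longrightarrow> f \<in> H"
  unfolding H_def by (intro generate.incl) blast

lemma commutator_in_D: "f \<in> H \<Longrightarrow> h \<in> H \<Longrightarrow> commutator f h \<in> D"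
  unfolding D_def by (rule commutator_in_derived[OF H_carrier])

text \<open>Conjugation permutes the generating rigid stabilisers, because translates of
  compressible clopen sets are again such sets.\<close>

lemma H_conj:
  assumes g: "g \<in> G" and x: "x \<in> H"
  shows "g \<circ> x \<circ> finv g \<in> H"
proof -
  have "g \<otimes>\<^bsub>homeo_group\<^esub> x \<otimes>\<^bsub>homeo_group\<^esub> inv\<^bsub>homeo_group\<^esub> g \<in> generate homeo_group (\<Union>{rist G Y |Y. cc Y})"
  proof (rule homeo.generate_conj_closed[OF generators_subset G_carrier[OF g] _ x[unfolded H_def]])
    fix r assume "r \<in> \<Union>{rist G Y |Y. cc Y}"
    then obtain Y where Y: "cc Y" "r \<in> rist G Y" by blast
    have "g \<circ> r \<circ> finv g \<in> H" by (rule rist_in_H[OF cc_image[OF Y(1) g] rist_conj[OF g Y(2)]])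
    then show "g \<otimes>\<^bsub>homeo_group\<^esub> r \<otimes>\<^bsub>homeo_group\<^esub> inv\<^bsub>homeo_group\<^esub> g \<in> generate homeo_group (\<Union>{rist G Y |Y. cc Y})"
      using m_inv_homeo_group[OF G_carrier[OF g]] by (simp add: H_def)
  qed
  then show ?thesis using m_inv_homeo_group[OF G_carrier[OF g]] by (simp add: H_def)
qed

lemma D_conj:
  assumes g: "g \<in> G" and x: "x \<in> D"
  shows "g \<circ> x \<circ> finv g \<in> D"
  using homeo.derived_conj_closed[OF H_carrier G_carrier[OF g] _ x[unfolded D_def]] H_conj[OF g]
    m_inv_homeo_group[OF G_carrier[OF g]] by (simp add: D_def)

section \<open>Non-trivial normal subgroups contain \<open>D\<close>\<close>

text \<open>Some \<open>n\<close> in \<open>N\<close> moves a clopen set \<open>A\<close> off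
  itself. If \<open>k\<close> compresses \<open>Y\<close> into \<open>A\<close>, then the conjugate
  k^-1 n k, again in \<open>N\<close>, moves \<open>Y\<close> off itself and
  \<open>commutator_rist_mem\<close> applies.\<close>

lemma normal_contains_commutator_same:
  assumes N: "subgroup N homeo_group" "N \<subseteq> G" "N \<noteq> {id}"
    and norm: "\<And>g n. g \<in> G \<Longrightarrow> n \<in> N \<Longrightarrow> g \<circ> n \<circ> finv g \<in> N"
    and Y: "cc Y" and f: "f \<in> rist G Y" and h: "h \<in> rist G Y"
  shows "commutator f h \<in> N"
proof -
  obtain n x where n: "n \<in> N" "n x \<noteq> x" using ex_moved_point[OF N(3,2) homeo_subgroupD(2)[OF N(1)]] .
  then have nG: "n \<in> G" using N by auto
  obtain A where A: "open A" "closed A" "x \<in> A" "A \<subseteq> UNIV" "n ` A \<inter> A = {}"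
    by (rule moved_clopen[OF nG n(2) open_UNIV UNIV_I])
  obtain k where k: "k \<in> G" "k ` Y \<subseteq> A" using compressibleD[of Y A] A Y by blast
  define n' where "n' = finv k \<circ> n \<circ> finv (finv k)"
  have "n' \<in> N" unfolding n'_def by (intro norm G_inv k n)
  moreover have "n' ` Y \<inter> Y = {}"
  proof -
    have "finv (finv k) = k" using G_carrier[OF k(1)] by (auto simp: carrier_homeo_group inv_inv_eq)
    then have "k (n' y) = n (k y)" for y using G_apply(2)[OF k(1)] by (simp add: n'_def)
    then have "n' y \<notin> Y" if "y \<in> Y" for y using that k(2) A(5) by (metis disjoint_iff image_eqI subsetD)
    then show ?thesis by blast
  qed
  ultimately show ?thesis using commutator_rist_mem[OF N(1) G_subset norm _ _ f h] by blast
qed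

text \<open>If \<open>Y1 \<union> Y2\<close> is the whole space and \<open>f\<close> moves a point \<open>b\<close> outside \<open>Y2\<close>, then \<open>f\<close> is the product
  of an exchange near \<open>b\<close> and an element fixing a neighbourhood of \<open>b\<close>; the support of each factor
  together with \<open>Y2\<close> is a proper subset.\<close>

lemma normal_contains_commutator:
  assumes N: "subgroup N homeo_group" "N \<subseteq> G" "N \<noteq> {id}"
    and norm: "\<And>g n. g \<in> G \<Longrightarrow> n \<in> N \<Longrightarrow> g \<circ> n \<circ> finv g \<in> N"
    and Y: "cc Y1" "cc Y2" and f: "f \<in> rist G Y1" and h: "h \<in> rist G Y2"
  shows "commutator f h \<in> N"
proof -
  \<comment> \<open>If the union of the supports is proper, it is compressible by
    \<open>cc_Un\<close> and can serve as a common support.\<close>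
  have proper: "commutator f h \<in> N"
    if "cc Y1" "Y1 \<union> Y2 \<noteq> UNIV" "f \<in> rist G Y1" for Y1 f
    using normal_contains_commutator_same[OF N norm cc_Un[OF that(1) Y(2) that(2)]]
      rist_mono[OF that(3), of "Y1 \<union> Y2"] rist_mono[OF h, of "Y1 \<union> Y2"] by blast
  consider "Y1 \<union> Y2 \<noteq> UNIV" | "f \<in> rist G Y2" | b where "Y1 \<union> Y2 = UNIV" "b \<notin> Y2" "f b \<noteq> b"
    using f by (auto simp: rist_def)
  then show ?thesis
  proof cases
    case 1
    then show ?thesis using proper Y f by blast
  next
    case 2
    then show ?thesis using normal_contains_commutator_same[OF N norm Y(2) _ h] by blast
  next
    case 3
    have fG: "f \<in> G" using f by (simp add: rist_def)
    have "open (- Y2)" "- Y2 \<noteq> {}" "finite {b, f b}" using Y 3 by auto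
    \<comment> \<open>The point \<open>p\<close> will lie outside \<open>B\<close>, its image under
      \<open>f\<close> and \<open>Y2\<close>, so that the support of the exchange together with
      \<open>Y2\<close> stays proper.\<close>
    then obtain p where p: "p \<in> - Y2" "p \<notin> {b, f b}" by (rule avoiding)
    have "open (- Y2 \<inter> - {p} \<inter> f -` (- {p}))"
      using Y G_continuous[OF fG] by (intro open_Int open_vimage) auto
    moreover have "b \<in> - Y2 \<inter> - {p} \<inter> f -` (- {p})" using 3 p by auto
    ultimately obtain B where B: "open B" "closed B" "b \<in> B" "B \<subseteq> - Y2 \<inter> - {p} \<inter> f -` (- {p})"
      "f ` B \<inter> B = {}" by (rule moved_clopen[OF fG 3(3)])
    have BY1: "B \<subseteq> Y1" using B 3 by blast
    then have fBY1: "f ` B \<subseteq> Y1" using rist_maps(1)[OF G_subset f] by blast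
    define s where "s = exchange f B"
    define t where "t = finv s \<circ> f"
    have s: "s \<in> rist G (B \<union> f ` B)" unfolding s_def by (rule exchange_rist[OF fG B(1,2,5)]) simp
    then have sG: "s \<in> G" by (simp add: rist_def)
    have t: "t \<in> rist G (Y1 - B)"
    proof -
      have "t \<in> G" unfolding t_def by (intro G_comp G_inv sG fG)
      moreover have "t x = x" if "x \<in> B" for x
        using that G_apply(1)[OF sG, of x] by (simp add: t_def s_def exchange_def)
      moreover have "t x = x" if "x \<notin> Y1" for x
      proof -
        have "f x = x" "s x = x" using that f s subsetD[OF BY1, of x] subsetD[OF fBY1, of x] by (auto simp: rist_def)
        then show ?thesis using G_apply(1)[OF sG, of x] by (simp add: t_def)
      qed
      ultimately show ?thesis by (auto simp: rist_def)
    qed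
    have tG: "t \<in> G" using t by (simp add: rist_def)
    have hG: "h \<in> G" using h by (simp add: rist_def)
    have st: "f = s \<circ> t" using G_apply(2)[OF sG] by (auto simp: t_def)
    have "commutator s h \<in> N"
    proof (rule proper[OF _ _ s])
      show "cc (B \<union> f ` B)"
        using B G_image[OF fG] compressible_subset[of Y1 "B \<union> f ` B"] Y BY1 fBY1 by auto
      show "B \<union> f ` B \<union> Y2 \<noteq> UNIV" using p B by blast
    qed
    moreover have "commutator t h \<in> N"
    proof (rule proper[OF _ _ t])
      show "cc (Y1 - B)" using B compressible_subset[of Y1 "Y1 - B"] Y by (auto simp: open_Diff closed_Diff)
      show "Y1 - B \<union> Y2 \<noteq> UNIV" using 3 B by blast
    qed
    \<comment> \<open>With f = s t, the identity [st, h] = s [t, h] s^-1 [s, h] joins the two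
      factors.\<close>
    ultimately have "(s \<circ> commutator t h \<circ> finv s) \<circ> commutator s h \<in> N"
      using norm[OF sG] homeo_subgroupD(3)[OF N(1)] by blast
    moreover have "(s \<circ> commutator t h \<circ> finv s) \<circ> commutator s h = commutator f h"
    proof -
      have "finv f = finv t \<circ> finv s"
        unfolding st using G_carrier[OF sG] G_carrier[OF tG]
        by (intro o_inv_distrib) (auto simp: carrier_homeo_group)
      then show ?thesis
        using G_apply(1)[OF sG] G_apply(1)[OF hG] by (simp add: commutator_def fun_eq_iff st)
    qed
    ultimately show ?thesis by simp
  qed
qed

text \<open>Modulo \<open>N\<close> the generators of \<open>H\<close> commute pairwise, so
  \<open>derived_generate_incl\<close> applies.\<close>

lemma normal_contains_D:
  assumes N: "subgroup N homeo_group" "N \<subseteq> G" "N \<noteq> {id}"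
    and norm: "\<And>g n. g \<in> G \<Longrightarrow> n \<in> N \<Longrightarrow> g \<circ> n \<circ> finv g \<in> N"
  shows "D \<subseteq> N"
  unfolding D_def H_def
proof (rule homeo.derived_generate_incl[OF generators_subset N(1)])
  fix h n assume "h \<in> generate homeo_group (\<Union>{rist G Y |Y. cc Y})" "n \<in> N"
  then have "h \<in> G" "n \<in> N" using H_subset H_def by auto
  then show "h \<otimes>\<^bsub>homeo_group\<^esub> n \<otimes>\<^bsub>homeo_group\<^esub> inv\<^bsub>homeo_group\<^esub> h \<in> N"
    using norm m_inv_homeo_group[OF G_carrier] by simp
next
  fix r s assume "r \<in> \<Union>{rist G Y |Y. cc Y}" "s \<in> \<Union>{rist G Y |Y. cc Y}"
  then obtain Y1 Y2 where Y: "cc Y1" "cc Y2" "r \<in> rist G Y1" "s \<in> rist G Y2" by blast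
  have "commutator r s \<in> N" by (intro normal_contains_commutator[OF N _ Y] norm)
  moreover have "r \<in> carrier homeo_group" "s \<in> carrier homeo_group"
    using Y G_subset by (auto simp: rist_def)
  ultimately show "r \<otimes>\<^bsub>homeo_group\<^esub> s \<otimes>\<^bsub>homeo_group\<^esub> inv\<^bsub>homeo_group\<^esub> r \<otimes>\<^bsub>homeo_group\<^esub> inv\<^bsub>homeo_group\<^esub> s \<in> N"
    using commutator_eq_homeo_group[of r s] by metis
qed

section \<open>Agreement of \<open>D\<close> with \<open>G\<close> on compressible sets\<close>

text \<open>Move \<open>C\<close> by \<open>k\<close> to a third copy disjoint from \<open>C\<close>
  and g(C). The swaps \<open>a\<close> of \<open>C\<close> with g(C) and \<open>b\<close> of
  \<open>C\<close> with k(C) have as commutator a 3-cycle of the copies: on \<open>C\<close>, the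
  map \<open>finv b\<close> goes to k(C), \<open>finv a\<close> does nothing there, \<open>b\<close>
  returns to \<open>C\<close>, and \<open>a\<close> acts as \<open>g\<close>.\<close>

lemma D_agrees_disjoint:
  assumes C: "cc C" and g: "g \<in> G" and disj: "g ` C \<inter> C = {}" "C \<union> g ` C \<noteq> UNIV"
  obtains d where "d \<in> D" "\<And>x. x \<in> C \<Longrightarrow> d x = g x"
proof (cases "C = {}")
  case True
  then show ?thesis using that homeo_subgroupD(2)[OF subgroup_D] by blast
next
  case False
  have cgC: "cc (g ` C)" using cc_image[OF C g] .
  have CgC: "cc (C \<union> g ` C)" using cc_Un[OF C cgC disj(2)] .
  have "open (- (C \<union> g ` C))" using CgC by (intro open_Compl) simp
  moreover have "- (C \<union> g ` C) \<noteq> {}" using disj(2) by blast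
  ultimately obtain k where k: "k \<in> G" "k ` C \<subseteq> - (C \<union> g ` C)"
    using compressibleD[of C "- (C \<union> g ` C)"] C by blast
  have kC: "k ` C \<inter> C = {}" using k(2) by blast
  \<comment> \<open>The non-empty set g(C) is disjoint from both; this is where the case of empty
    \<open>C\<close> had to be split off.\<close>
  have "C \<union> k ` C \<noteq> UNIV" using False disj(1) k(2) by blast
  then have CkC: "cc (C \<union> k ` C)" using cc_Un[OF C cc_image[OF C k(1)]] by blast
  define a where "a = exchange g C"
  define b where "b = exchange k C"
  have a: "a \<in> rist G (C \<union> g ` C)" unfolding a_def using C disj(1) by (intro exchange_rist g) auto
  have b: "b \<in> rist G (C \<union> k ` C)" unfolding b_def using C kC by (intro exchange_rist k(1)) auto
  have aG: "a \<in> G" and bG: "b \<in> G" using a b by (auto simp: rist_def)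
  have "commutator a b x = g x" if x: "x \<in> C" for x
  proof -
    have kx: "k x \<in> - (C \<union> g ` C)" "k x \<in> k ` C" using k(2) x by auto
    then have "b (k x) = x" using G_apply(1)[OF k(1), of x] by (auto simp: b_def exchange_def)
    moreover from this have "finv b x = k x" using G_apply(1)[OF bG, of "k x"] by simp
    moreover have "finv a (k x) = k x" using kx by (intro rist_inv[OF G_subset a]) auto
    moreover have "a x = g x" using x by (simp add: a_def exchange_def)
    ultimately show ?thesis by (simp add: commutator_def)
  qed
  moreover have "commutator a b \<in> D"
    by (intro commutator_in_D rist_in_H[OF CgC a] rist_in_H[OF CkC b])
  ultimately show ?thesis using that by blast
qed

text \<open>On \<open>C\<close> the map \<open>g\<close> factors as g k^-1 after \<open>k\<close>,
  and \<open>D\<close> is closed under composition.\<close>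

lemma D_agrees_via:
  assumes k: "k \<in> G" and g: "g \<in> G"
    and d1: "\<exists>d\<in>D. \<forall>x\<in>C. d x = k x"
    and d2: "\<exists>d\<in>D. \<forall>x\<in>k ` C. d x = (g \<circ> finv k) x"
  shows "\<exists>d\<in>D. \<forall>x\<in>C. d x = g x"
proof -
  obtain d d' where d: "d \<in> D" "\<forall>x\<in>C. d x = k x" "d' \<in> D" "\<forall>x\<in>k ` C. d' x = (g \<circ> finv k) x"
    using d1 d2 by blast
  then have "d' \<circ> d \<in> D" using homeo_subgroupD(3)[OF subgroup_D] by blast
  moreover have "\<forall>x\<in>C. (d' \<circ> d) x = g x" using d(2,4) G_apply(1)[OF k] by simp
  ultimately show ?thesis by blast
qed

lemma image_via:
  assumes "k \<in> G"
  shows "(g \<circ> finv k) ` k ` C = g ` C"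
  using G_apply(1)[OF assms] by (simp add: image_image)

text \<open>Here g(C) may meet \<open>C\<close>. Both are disjoint from an intermediate copy k(C),
  and \<open>p\<close> remains outside all three sets, so each of the two moves is of the disjoint
  kind.\<close>

lemma D_agrees_proper:
  assumes C: "cc C" and g: "g \<in> G" and CgC: "C \<union> g ` C \<noteq> UNIV"
  shows "\<exists>d\<in>D. \<forall>x\<in>C. d x = g x"
proof -
  have cgC: "cc (g ` C)" using cc_image[OF C g] .
  have "open (- (C \<union> g ` C))" using C cgC by (intro open_Compl closed_Un) auto
  moreover obtain p where p: "p \<in> - (C \<union> g ` C)" using CgC by blast
  ultimately obtain P where P: "open P" "closed P" "P \<noteq> {}" "P \<subseteq> - (C \<union> g ` C)" "P \<inter> {p} = {}"
    using clopen_avoiding[of "- (C \<union> g ` C)" "{p}"] by (metis empty_iff finite.emptyI finite.insertI)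
  obtain k where k: "k \<in> G" "k ` C \<subseteq> P" using compressibleD[of C P] C P by blast
  have ck: "cc (k ` C)" using cc_image[OF C k(1)] .
  show ?thesis
  proof (rule D_agrees_via[OF k(1) g])
    have "k ` C \<inter> C = {}" "C \<union> k ` C \<noteq> UNIV" using k P p by blast+
    then show "\<exists>d\<in>D. \<forall>x\<in>C. d x = k x" using D_agrees_disjoint[OF C k(1)] by metis
    have "g ` C \<inter> k ` C = {}" "k ` C \<union> g ` C \<noteq> UNIV" using k P p by blast+
    then show "\<exists>d\<in>D. \<forall>x\<in>k ` C. d x = (g \<circ> finv k) x"
      using D_agrees_disjoint[OF ck G_comp[OF g G_inv[OF k(1)]]] unfolding image_via[OF k(1)] by metis
  qed
qed

text \<open>Now \<open>C\<close> and g(C) may cover the space. The intermediate copy avoids a point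
  \<open>p\<close> outside \<open>C\<close> and a point \<open>q\<close> outside g(C), so
  \<open>C \<union> k(C)\<close> misses \<open>p\<close> and \<open>k(C) \<union> g(C)\<close>
  misses \<open>q\<close>.\<close>

lemma D_agrees:
  assumes C: "cc C" and g: "g \<in> G"
  obtains d where "d \<in> D" "\<And>x. x \<in> C \<Longrightarrow> d x = g x"
proof -
  have cgC: "cc (g ` C)" using cc_image[OF C g] .
  obtain p q where pq: "p \<notin> C" "q \<notin> g ` C" using cc_neq_UNIV[OF C] cc_neq_UNIV[OF cgC] by blast
  have "finite {p, q}" by simp
  then obtain P :: "'a set" where P: "open P" "closed P" "P \<noteq> {}" "P \<subseteq> UNIV" "P \<inter> {p, q} = {}"
    by (rule clopen_avoiding[OF open_UNIV UNIV_not_empty])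
  obtain k where k: "k \<in> G" "k ` C \<subseteq> P" using compressibleD[of C P] C P by blast
  have "\<exists>d\<in>D. \<forall>x\<in>C. d x = g x"
  proof (rule D_agrees_via[OF k(1) g])
    have "C \<union> k ` C \<noteq> UNIV" using k P pq by blast
    then show "\<exists>d\<in>D. \<forall>x\<in>C. d x = k x" by (rule D_agrees_proper[OF C k(1)])
    have "k ` C \<union> g ` C \<noteq> UNIV" using k P pq by blast
    then show "\<exists>d\<in>D. \<forall>x\<in>k ` C. d x = (g \<circ> finv k) x"
      using D_agrees_proper[OF cc_image[OF C k(1)] G_comp[OF g G_inv[OF k(1)]]]
      unfolding image_via[OF k(1)] by blast
  qed
  then show ?thesis using that by blast
qed

section \<open>Elements with small support\<close>

text \<open>Two disjoint open pieces of a compressible set contain a clopen set and a translate of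
  it, which can be exchanged.\<close>

lemma rist_nontrivial:
  fixes U :: "'a set"
  assumes "open U" "U \<noteq> {}"
  obtains Y f x where "cc Y" "Y \<subseteq> U" "f \<in> rist G Y" "f x \<noteq> x"
proof -
  obtain Y where Y: "cc Y" "Y \<noteq> {}" "Y \<subseteq> U" by (rule ex_cc[OF assms])
  obtain V W where VW: "open V" "open W" "V \<noteq> {}" "W \<noteq> {}" "V \<inter> W = {}" "V \<subseteq> Y" "W \<subseteq> Y"
    by (rule split_open[OF conjunct1[OF Y(1)] Y(2)])
  obtain C where C: "cc C" "C \<noteq> {}" "C \<subseteq> V" by (rule ex_cc[OF VW(1,3)])
  obtain k where k: "k \<in> G" "k ` C \<subseteq> W" using compressibleD[of C W] C VW by blast
  obtain x where x: "x \<in> C" using C by blast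
  have "exchange k C \<in> rist G Y" using C k VW by (intro exchange_rist) auto
  moreover have "k x \<noteq> x" using x k(2) C(3) VW(5) by force
  then have "exchange k C x \<noteq> x" using x by (simp add: exchange_def)
  ultimately show ?thesis using that Y by blast
qed

text \<open>If \<open>f\<close> moves \<open>A\<close> off itself and \<open>h\<close> is
  non-trivial with support in \<open>A\<close>, then their commutator is non-trivial; both can be
  taken in the rigid stabiliser of one compressible set, so it lies in \<open>D\<close>.\<close>

lemma rist_D_nontrivial:
  fixes U :: "'a set"
  assumes U: "open U" "U \<noteq> {}"
  obtains c x where "c \<in> rist D U" "c x \<noteq> x"
proof -
  obtain Y f x where f: "cc Y" "Y \<subseteq> U" "f \<in> rist G Y" "f x \<noteq> x" by (rule rist_nontrivial[OF U])
  have fG: "f \<in> G" and x: "x \<in> Y" using f by (auto simp: rist_def)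
  obtain A where A: "open A" "closed A" "x \<in> A" "A \<subseteq> Y" "f ` A \<inter> A = {}"
    by (rule moved_clopen[OF fG f(4) conjunct1[OF f(1)] x])
  have "A \<noteq> {}" using A by blast
  with A(1) obtain Z h y where h: "cc Z" "Z \<subseteq> A" "h \<in> rist G Z" "h y \<noteq> y" by (rule rist_nontrivial)
  have hA: "h \<in> rist G A" using rist_mono h by blast
  have hY: "h \<in> rist G Y" using rist_mono hA A by blast
  have "commutator f h \<in> D" by (intro commutator_in_D rist_in_H[OF f(1)] f(3) hY)
  then have "commutator f h \<in> rist D U"
    using commutator_rist[OF f(3) hY] f(2) by (auto simp: rist_def)
  moreover have "commutator f h \<noteq> id" by (rule commutator_neq_id(2)[OF fG A(5) hA h(4)])
  ultimately show ?thesis using that by (auto simp: fun_eq_iff)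
qed

lemma rist_D_noncommuting:
  fixes U :: "'a set"
  assumes U: "open U" "U \<noteq> {}"
  obtains f h where "f \<in> rist D U" "h \<in> rist D U" "f \<circ> h \<noteq> h \<circ> f" "commutator f h \<noteq> id"
proof -
  obtain f x where f: "f \<in> rist D U" "f x \<noteq> x" by (rule rist_D_nontrivial[OF U])
  have fG: "f \<in> G" and x: "x \<in> U" using f D_subset by (auto simp: rist_def)
  obtain A where A: "open A" "closed A" "x \<in> A" "A \<subseteq> U" "f ` A \<inter> A = {}"
    by (rule moved_clopen[OF fG f(2) U(1) x])
  have "A \<noteq> {}" using A by blast
  with A(1) obtain h y where h: "h \<in> rist D A" "h y \<noteq> y" by (rule rist_D_nontrivial)
  have hA: "h \<in> rist G A" using h D_subset by (auto simp: rist_def)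
  show ?thesis
    using that[OF f(1) rist_mono[OF h(1) A(4)]] commutator_neq_id[OF fG A(5) hA h(2)] by blast
qed

text \<open>On a compressible set every element of \<open>G\<close> agrees with some element of \<open>D\<close>, so a subgroup
  normalised by \<open>D\<close> contains all \<open>G\<close>-conjugates of its elements supported there: its core in \<open>G\<close> is
  non-trivial.\<close>

lemma D_least:
  assumes N: "subgroup N homeo_group" "N \<subseteq> G" "N \<noteq> {id}"
    and norm: "\<And>d n. d \<in> D \<Longrightarrow> n \<in> N \<Longrightarrow> d \<circ> n \<circ> finv d \<in> N"
  shows "D \<subseteq> N"
proof -
  define T where "T = {t \<in> G. \<forall>g\<in>G. g \<circ> t \<circ> finv g \<in> N}"
  have T: "subgroup T homeo_group"
  proof (rule homeo_subgroupI)
    show "T \<subseteq> carrier homeo_group" using G_carrier by (auto simp: T_def)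
    have "g \<circ> id \<circ> finv g = id" if "g \<in> G" for g using G_apply(2)[OF that] by auto
    then show "id \<in> T" using G_id homeo_subgroupD(2)[OF N(1)] by (simp add: T_def del: comp_id o_id)
  next
    fix s t assume st: "s \<in> T" "t \<in> T"
    have "g \<circ> (s \<circ> t) \<circ> finv g = (g \<circ> s \<circ> finv g) \<circ> (g \<circ> t \<circ> finv g)" if "g \<in> G" for g
      using G_apply(1)[OF that] by (simp add: fun_eq_iff)
    then show "s \<circ> t \<in> T" using st homeo_subgroupD(3)[OF N(1)] G_comp by (simp add: T_def)
  next
    fix t assume t: "t \<in> T"
    then have tG: "t \<in> G" by (simp add: T_def)
    have "g \<circ> finv t \<circ> finv g \<in> N" if g: "g \<in> G" for g
    proof -
      have "(g \<circ> t \<circ> finv g) \<circ> (g \<circ> finv t \<circ> finv g) = id"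
        "(g \<circ> finv t \<circ> finv g) \<circ> (g \<circ> t \<circ> finv g) = id"
        using G_apply(1,2)[OF g] G_apply(1,2)[OF tG] by (simp_all add: fun_eq_iff)
      then have "finv (g \<circ> t \<circ> finv g) = g \<circ> finv t \<circ> finv g" by (rule inv_unique_comp)
      moreover have "finv (g \<circ> t \<circ> finv g) \<in> N" using t g homeo_subgroupD(4)[OF N(1)] by (simp add: T_def)
      ultimately show ?thesis by simp
    qed
    then show "finv t \<in> T" using G_inv[OF tG] by (simp add: T_def)
  qed
  have TN: "T \<subseteq> N" using G_id by (auto simp: T_def)
  have Tnorm: "g \<circ> t \<circ> finv g \<in> T" if g: "g \<in> G" and t: "t \<in> T" for g t
  proof -
    have "h \<circ> (g \<circ> t \<circ> finv g) \<circ> finv h \<in> N" if h: "h \<in> G" for h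
    proof -
      have "finv (h \<circ> g) = finv g \<circ> finv h"
        using G_carrier[OF g] G_carrier[OF h] by (intro o_inv_distrib) (auto simp: carrier_homeo_group)
      moreover have "(h \<circ> g) \<circ> t \<circ> finv (h \<circ> g) \<in> N" using t G_comp[OF h g] by (simp add: T_def)
      ultimately show ?thesis by (simp add: o_assoc)
    qed
    then show ?thesis using g t by (auto simp: T_def intro!: G_comp G_inv)
  qed
  obtain n x where n: "n \<in> N" "n x \<noteq> x"
    by (rule ex_moved_point[OF N(3,2) homeo_subgroupD(2)[OF N(1)]])
  have nG: "n \<in> G" using N n by auto
  obtain A where A: "open A" "closed A" "x \<in> A" "A \<subseteq> UNIV" "n ` A \<inter> A = {}"
    by (rule moved_clopen[OF nG n(2) open_UNIV UNIV_I])
  have "A \<noteq> {}" using A by blast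
  with A(1) obtain C where C: "cc C" "C \<noteq> {}" "C \<subseteq> A" by (rule ex_cc)
  \<comment> \<open>Both are taken from \<open>D\<close>, since only \<open>D\<close> is known to
    normalise \<open>N\<close> and \<open>commutator_rist_mem\<close> needs that.\<close>
  obtain f h where fh: "f \<in> rist D C" "h \<in> rist D C" "commutator f h \<noteq> id"
    by (rule rist_D_noncommuting[OF conjunct1[OF C(1)] C(2)])
  have fhG: "f \<in> rist G C" "h \<in> rist G C" using fh D_subset by (auto simp: rist_def)
  have "n ` C \<inter> C = {}" using A C by blast
  then have cN: "commutator f h \<in> N"
    using commutator_rist_mem[OF N(1) D_carrier _ n(1) _ fh(1,2)] norm by blast
  have c: "commutator f h \<in> rist G C" by (rule commutator_rist[OF fhG])
  have "commutator f h \<in> T"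
  proof -
    have "g \<circ> commutator f h \<circ> finv g \<in> N" if g: "g \<in> G" for g
    proof -
      obtain d where d: "d \<in> D" "\<And>x. x \<in> C \<Longrightarrow> d x = g x" by (rule D_agrees[OF C(1) g]) blast
      have "g \<circ> commutator f h \<circ> finv g = d \<circ> commutator f h \<circ> finv d"
        using d D_subset by (intro rist_conj_eq[OF c g]) auto
      then show ?thesis using norm[OF d(1) cN] by simp
    qed
    then show ?thesis using c by (simp add: T_def rist_def)
  qed
  then have "T \<noteq> {id}" using fh(3) by auto
  moreover have "T \<subseteq> G" by (auto simp: T_def)
  \<comment> \<open>Unlike \<open>N\<close>, the core \<open>T\<close> is normalised by all of
    \<open>G\<close>.\<close>
  ultimately have "D \<subseteq> T" using normal_contains_D[OF T] Tnorm by blast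
  then show ?thesis using TN by blast
qed

section \<open>Compact spaces with a minimal action\<close>

text \<open>By minimality the translates of one non-empty compressible clopen set cover the space,
  and by compactness finitely many of them cover \<open>Z\<close>; \<open>cc_Un\<close> then
  assembles \<open>Z\<close> from its intersections with these.\<close>

lemma cc_of_clopen:
  assumes comp: "compact (UNIV :: 'a set)" and min: "minimal_action G"
    and Z: "open Z" "closed Z" "Z \<noteq> UNIV"
  shows "cc Z"
proof -
  obtain Y where Y: "cc Y" "Y \<noteq> {}" "Y \<subseteq> UNIV" by (rule ex_cc[OF open_UNIV UNIV_not_empty])
  have cover: "\<exists>W. cc W \<and> x \<in> W" for x
  proof -
    have "closure {g x |g. g \<in> G} = UNIV" using min by (simp add: minimal_action_def)
    then have "Y \<inter> {g x |g. g \<in> G} \<noteq> {}" 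
      using open_Int_closure_eq_empty[of Y "{g x |g. g \<in> G}"] Y by simp
    then obtain g where g: "g \<in> G" "g x \<in> Y" by blast
    then have "x \<in> finv g ` Y" using G_apply(1)[OF g(1), of x] by (metis imageI)
    then show ?thesis using cc_image[OF Y(1) G_inv[OF g(1)]] by blast
  qed
  have "compact Z" using comp Z(2) compact_Int_closed[of UNIV Z] by simp
  moreover have "Z \<subseteq> \<Union>{W. cc W}" using cover by blast
  moreover have "open W" if "W \<in> {W. cc W}" for W using that by simp
  ultimately obtain F where F: "F \<subseteq> {W. cc W}" "finite F" "Z \<subseteq> \<Union>F"
    by (rule compactE)
  \<comment> \<open>Intersecting with \<open>Z\<close> before taking unions keeps every partial
    union proper, as \<open>cc_Un\<close> demands.\<close>
  have "cc (\<Union>F' \<inter> Z)" if "finite F'" "F' \<subseteq> {W. cc W}" for F'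
    using that
  proof (induction rule: finite_induct)
    case empty
    then show ?case using G_id by (auto simp: compressible_set_def)
  next
    case (insert W F')
    then have W: "cc (W \<inter> Z)"
      using Z compressible_subset[of W "W \<inter> Z"] by (auto intro: open_Int closed_Int)
    have "cc (\<Union>F' \<inter> Z)" using insert by simp
    then have "cc ((W \<inter> Z) \<union> (\<Union>F' \<inter> Z))" using Z(3) by (intro cc_Un[OF W]) auto
    moreover have "(W \<inter> Z) \<union> (\<Union>F' \<inter> Z) = \<Union>(insert W F') \<inter> Z" by auto
    ultimately show ?case by metis
  qed
  then have "cc (\<Union>F \<inter> Z)" using F by blast
  moreover have "\<Union>F \<inter> Z = Z" using F by blast
  ultimately show ?thesis by metis
qed

text \<open>A non-trivial \<open>g\<close> is the product of an exchange of a small clopen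
  \<open>A\<close> with its image and of an element fixing \<open>A\<close> pointwise. Both supports
  lie in proper clopen sets, which are compressible here.\<close>

lemma H_eq_G:
  assumes comp: "compact (UNIV :: 'a set)" and min: "minimal_action G"
  shows "H = G"
proof
  show "G \<subseteq> H"
  proof
    fix g assume g: "g \<in> G"
    show "g \<in> H"
    proof (cases "g = id")
      case True
      then show ?thesis using homeo_subgroupD(2)[OF subgroup_H] by simp
    next
      case False
      then obtain x where x: "g x \<noteq> x" by (auto simp: fun_eq_iff)
      have "finite {x, g x}" by simp
      \<comment> \<open>A third point, kept outside \<open>A\<close> and its image so that their
        union is proper.\<close>
      then obtain p where p: "p \<in> UNIV" "p \<notin> {x, g x}" by (rule avoiding[OF open_UNIV UNIV_not_empty])
      have "open (- {p} \<inter> g -` (- {p}))"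
        using G_continuous[OF g] by (intro open_Int open_vimage) auto
      moreover have "x \<in> - {p} \<inter> g -` (- {p})" using p by auto
      ultimately obtain A where A: "open A" "closed A" "x \<in> A" "A \<subseteq> - {p} \<inter> g -` (- {p})"
        "g ` A \<inter> A = {}" by (rule moved_clopen[OF g x])
      define s where "s = exchange g A"
      define t where "t = finv s \<circ> g"
      have s: "s \<in> rist G (A \<union> g ` A)" unfolding s_def by (rule exchange_rist[OF g A(1,2,5)]) simp
      then have sG: "s \<in> G" by (simp add: rist_def)
      have "A \<union> g ` A \<noteq> UNIV" using A(4) by blast
      then have "cc (A \<union> g ` A)" using A G_image[OF g] by (intro cc_of_clopen[OF assms]) auto
      then have sH: "s \<in> H" using rist_in_H s by blast
      have "t x = x" if "x \<in> A" for x
        using that G_apply(1)[OF sG, of x] by (simp add: t_def s_def exchange_def)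
      then have t: "t \<in> rist G (- A)" using G_comp[OF G_inv[OF sG] g] by (simp add: rist_def t_def)
      have "cc (- A)" using A by (intro cc_of_clopen[OF assms]) auto
      then have "t \<in> H" using rist_in_H t by blast
      moreover have "g = s \<circ> t" using G_apply(2)[OF sG] by (auto simp: t_def)
      ultimately show ?thesis using homeo_subgroupD(3)[OF subgroup_H sH] by simp
    qed
  qed
qed (rule H_subset)

text \<open>A non-dense set lies in a proper clopen set, which some \<open>g\<close> in
  \<open>G\<close> compresses into \<open>U\<close>; an element of \<open>D\<close> agreeing with
  \<open>g\<close> there does the same.\<close>

lemma D_fully_compressible:
  assumes comp: "compact (UNIV :: 'a set)" and min: "minimal_action G"
  shows "fully_compressible_action D"
  unfolding fully_compressible_action_def compressible_set_def
proof (intro allI impI)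
  fix Y U :: "'a set"
  assume Y: "open Y \<and> closure Y \<noteq> UNIV" and U: "open U \<and> U \<noteq> {}"
  obtain x where x: "x \<in> - closure Y" using Y by blast
  obtain V where V: "open V" "closed V" "x \<in> V" "V \<subseteq> - closure Y"
    by (rule clopen_nbhd[OF open_Compl[OF closed_closure] x])
  have cV: "cc (- V)" using V by (intro cc_of_clopen[OF assms]) auto
  obtain g where g: "g \<in> G" "g ` (- V) \<subseteq> U" using compressibleD[of "- V" U] cV U by blast
  obtain d where d: "d \<in> D" "\<And>x. x \<in> - V \<Longrightarrow> d x = g x" by (rule D_agrees[OF cV g(1)]) blast
  have "d y \<in> U" if "y \<in> Y" for y
  proof -
    have "y \<in> - V" using that V(4) closure_subset by blast
    then show ?thesis using d(2) g(2) by auto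
  qed
  then show "\<exists>g\<in>D. g ` Y \<subseteq> U" using d(1) by blast
qed

end

section \<open>The monolith\<close>

context piecewise_full_group
begin

text \<open>This transfers the abstract criterion to \<open>G\<close> as a group in its own right,
  where inverses are still \<open>finv\<close>.\<close>

lemma monolith_eqI:
  assumes D: "subgroup D homeo_group" "D \<subseteq> G"
    and conj: "\<And>g d. g \<in> G \<Longrightarrow> d \<in> D \<Longrightarrow> g \<circ> d \<circ> finv g \<in> D"
    and ab: "a \<in> D" "b \<in> D" "a \<circ> b \<noteq> b \<circ> a"
    and least: "\<And>N. subgroup N homeo_group \<Longrightarrow> N \<subseteq> G \<Longrightarrow> N \<noteq> {id} \<Longrightarrow>
                  (\<And>d n. d \<in> D \<Longrightarrow> n \<in> N \<Longrightarrow> d \<circ> n \<circ> finv d \<in> N) \<Longrightarrow> D \<subseteq> N"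
  shows "monolith (homeo_group\<lparr>carrier := G\<rparr>) = D" and "almost_simple (homeo_group\<lparr>carrier := G\<rparr>)"
proof -
  let ?G = "homeo_group\<lparr>carrier := G\<rparr>"
  interpret GG: group ?G using homeo.subgroup_imp_group[OF subgroup_G] .
  have inv: "inv\<^bsub>?G\<^esub> g = finv g" if "g \<in> G" for g
    using homeo.m_inv_consistent[OF subgroup_G that] m_inv_homeo_group[OF G_carrier[OF that]] by simp
  have normal: "D \<lhd> ?G"
  proof (rule GG.normal_invI)
    show "subgroup D ?G" by (rule homeo.subgroup_incl[OF D(1) subgroup_G D(2)])
    show "x \<otimes>\<^bsub>?G\<^esub> h \<otimes>\<^bsub>?G\<^esub> inv\<^bsub>?G\<^esub> x \<in> D" if "x \<in> carrier ?G" "h \<in> D" for x h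
      using that conj[of x h] inv[of x] by simp
  qed
  have contained: "D \<subseteq> N"
    if N: "subgroup N ?G" "N \<noteq> {\<one>\<^bsub>?G\<^esub>}"
      and n: "\<And>d n. d \<in> D \<Longrightarrow> n \<in> N \<Longrightarrow> d \<otimes>\<^bsub>?G\<^esub> n \<otimes>\<^bsub>?G\<^esub> inv\<^bsub>?G\<^esub> d \<in> N" for N
  proof (rule least)
    show "subgroup N homeo_group" by (rule homeo.incl_subgroup[OF subgroup_G N(1)])
    show "N \<subseteq> G" using subgroup.subset[OF N(1)] by simp
    show "N \<noteq> {id}" using N(2) by simp
    show "d \<circ> m \<circ> finv d \<in> N" if "d \<in> D" "m \<in> N" for d m
      using n[OF that] inv[of d] D(2) that by auto
  qed
  have "a \<otimes>\<^bsub>?G\<^esub> b \<noteq> b \<otimes>\<^bsub>?G\<^esub> a" using ab(3) by simp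
  then show "monolith ?G = D" "almost_simple ?G"
    using GG.almost_simple_monolithI[OF normal ab(1,2)] contained by blast+
qed

end

section \<open>Spaces with isolated points\<close>

text \<open>For distinct points this sends \<open>a\<close> to \<open>b\<close>, \<open>b\<close> to
  \<open>c\<close> and \<open>c\<close> to \<open>a\<close>. As a product of two transpositions it
  has the reversed product as inverse for arbitrary arguments.\<close>

definition three_cycle :: "'a \<Rightarrow> 'a \<Rightarrow> 'a \<Rightarrow> 'a \<Rightarrow> 'a" where
  "three_cycle a b c = Transposition.transpose a b \<circ> Transposition.transpose b c"

lemma three_cycle_apply:
  assumes "distinct [a, b, c]"
  shows "three_cycle a b c x = (if x = a then b else if x = b then c else if x = c then a else x)"
  using assms by (auto simp: three_cycle_def Transposition.transpose_def)

lemma three_cycle_rotate: "distinct [a, b, c] \<Longrightarrow> three_cycle a b c = three_cycle b c a"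
  by (auto simp: fun_eq_iff three_cycle_apply)

lemma inv_three_cycle: "finv (three_cycle a b c) = three_cycle c b a"
proof (rule inv_unique_comp)
  show "three_cycle a b c \<circ> three_cycle c b a = id" "three_cycle c b a \<circ> three_cycle a b c = id"
    by (simp_all add: three_cycle_def fun_eq_iff transpose_commute)
qed

lemma three_cycle_conj:
  assumes "bij g" "distinct [a, b, c]"
  shows "g \<circ> three_cycle a b c \<circ> finv g = three_cycle (g a) (g b) (g c)"
proof
  fix x
  obtain z where x: "x = g z" using assms(1) by (metis bij_pointE)
  have eq: "g u = g v \<longleftrightarrow> u = v" for u v using assms(1) by (simp add: bij_is_inj inj_eq)
  show "(g \<circ> three_cycle a b c \<circ> finv g) x = three_cycle (g a) (g b) (g c) x"
    using assms by (simp add: x three_cycle_apply eq bij_is_inj)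
qed

locale isolated_compressible = compressible_full_group +
  fixes y0 :: 'a
  assumes isolated: "open {y0}"
    and infinite_space: "infinite (UNIV :: 'a set)"
begin

definition I :: "'a set" where
  "I = {x. open {x}}"

text \<open>The finitary alternating group on the isolated points; generation by 3-cycles avoids
  speaking of parity.\<close>

definition alternating :: "('a \<Rightarrow> 'a) set" where
  "alternating = generate homeo_group {three_cycle a b c |a b c. {a, b, c} \<subseteq> I \<and> distinct [a, b, c]}"

lemma I_image: "g \<in> G \<Longrightarrow> x \<in> I \<Longrightarrow> g x \<in> I"
  using G_image(1)[of g "{x}"] by (simp add: I_def)

text \<open>A non-empty compressible set exists inside every non-empty open set, and inside
  \<open>{y0}\<close> there is only one candidate.\<close>

lemma y0_compressible: "compressible_set G {y0}"
proof -
  obtain Y where "cc Y" "Y \<noteq> {}" "Y \<subseteq> {y0}" by (rule ex_cc[OF isolated insert_not_empty])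
  moreover from this have "Y = {y0}" by blast
  ultimately show ?thesis by metis
qed

lemma I_dense:
  assumes "open U" "U \<noteq> {}"
  obtains x where "x \<in> U" "x \<in> I"
proof -
  obtain g where "g \<in> G" "g ` {y0} \<subseteq> U" using compressibleD[OF y0_compressible assms] by blast
  moreover have "y0 \<in> I" using isolated by (simp add: I_def)
  ultimately show ?thesis using that[of "g y0"] I_image by simp
qed

lemma I_transitive:
  assumes "a \<in> I" "b \<in> I"
  obtains g where "g \<in> G" "g a = b"
proof -
  obtain g where g: "g \<in> G" "g y0 = a"
    using compressibleD[OF y0_compressible, of "{a}"] assms by (auto simp: I_def)
  obtain h where h: "h \<in> G" "h y0 = b"
    using compressibleD[OF y0_compressible, of "{b}"] assms by (auto simp: I_def)
  have "(h \<circ> finv g) a = b" using g h G_apply(1)[OF g(1), of y0] by simp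
  then show ?thesis using that[OF G_comp[OF h(1) G_inv[OF g(1)]]] by blast
qed

text \<open>A finite \<open>I\<close> would be closed, so its complement would be a non-empty open
  set, which density forces to meet \<open>I\<close>.\<close>

lemma infinite_I: "infinite I"
proof
  assume fin: "finite I"
  then have "open (- I)" by (intro open_Compl finite_imp_closed)
  moreover have "- I \<noteq> {}" using fin infinite_space by (metis Compl_empty_eq double_compl)
  ultimately obtain x where "x \<in> - I" "x \<in> I" by (rule I_dense)
  then show False by simp
qed

lemma fresh:
  assumes "finite S"
  obtains a where "a \<in> I" "a \<notin> S"
proof -
  have "infinite (I - S)" using infinite_I by (rule Diff_infinite_finite[OF assms])
  then have "I - S \<noteq> {}" by (metis finite.emptyI)
  then show ?thesis using that by blast
qed

lemma fresh2:
  assumes "finite S"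
  obtains a b where "a \<in> I" "b \<in> I" "a \<notin> S" "b \<notin> S" "a \<noteq> b"
proof -
  obtain a where a: "a \<in> I" "a \<notin> S" by (rule fresh[OF assms])
  have "finite (insert a S)" using assms by simp
  then obtain b where "b \<in> I" "b \<notin> insert a S" by (rule fresh)
  then show ?thesis using that a by blast
qed

text \<open>Singletons of isolated points are clopen, and the transposition is the exchange of two
  of them.\<close>

lemma transpose_mem:
  assumes "a \<in> I" "b \<in> I"
  shows "Transposition.transpose a b \<in> G"
proof (cases "a = b")
  case True
  then show ?thesis using G_id by simp
next
  case False
  obtain g where g: "g \<in> G" "g a = b" by (rule I_transitive[OF assms])
  have "exchange g {a} \<in> G" using g False assms by (intro exchange_mem) (auto simp: I_def)
  moreover have "exchange g {a} = Transposition.transpose a b"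
    using g G_apply(1)[OF g(1), of a] by (auto simp: exchange_def Transposition.transpose_def fun_eq_iff)
  ultimately show ?thesis by simp
qed

lemma three_cycle_mem: "{a, b, c} \<subseteq> I \<Longrightarrow> three_cycle a b c \<in> G"
  unfolding three_cycle_def by (intro G_comp transpose_mem) auto

lemma three_cycles_subset:
  "{three_cycle a b c |a b c. {a, b, c} \<subseteq> I \<and> distinct [a, b, c]} \<subseteq> G"
  using three_cycle_mem by blast

lemma subgroup_alternating: "subgroup alternating homeo_group"
  unfolding alternating_def using three_cycles_subset G_subset by (intro homeo.generate_is_subgroup) auto

lemma alternating_subset: "alternating \<subseteq> G"
  unfolding alternating_def by (rule homeo.generate_subgroup_incl[OF three_cycles_subset subgroup_G])

lemma three_cycle_in_alternating: "{a, b, c} \<subseteq> I \<Longrightarrow> distinct [a, b, c] \<Longrightarrow> three_cycle a b c \<in> alternating"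
  unfolding alternating_def by (intro generate.incl) blast

lemma alternating_conj:
  assumes g: "g \<in> G" and x: "x \<in> alternating"
  shows "g \<circ> x \<circ> finv g \<in> alternating"
proof -
  let ?R = "{three_cycle a b c |a b c. {a, b, c} \<subseteq> I \<and> distinct [a, b, c]}"
  have "g \<otimes>\<^bsub>homeo_group\<^esub> x \<otimes>\<^bsub>homeo_group\<^esub> inv\<^bsub>homeo_group\<^esub> g \<in> generate homeo_group ?R"
  proof (rule homeo.generate_conj_closed[OF _ G_carrier[OF g] _ x[unfolded alternating_def]])
    show "?R \<subseteq> carrier homeo_group" using three_cycles_subset G_subset by auto
    fix r assume "r \<in> ?R"
    then obtain a b c where r: "r = three_cycle a b c" "{a, b, c} \<subseteq> I" "distinct [a, b, c]" by blast
    have "bij g" using G_carrier[OF g] by (simp add: carrier_homeo_group)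
    then have "g \<circ> r \<circ> finv g = three_cycle (g a) (g b) (g c)" unfolding r(1) by (rule three_cycle_conj[OF _ r(3)])
    moreover have "{g a, g b, g c} \<subseteq> I" "distinct [g a, g b, g c]"
      using r I_image[OF g] G_apply(3)[OF g] by auto
    ultimately have "g \<circ> r \<circ> finv g \<in> alternating" using three_cycle_in_alternating by simp
    then show "g \<otimes>\<^bsub>homeo_group\<^esub> r \<otimes>\<^bsub>homeo_group\<^esub> inv\<^bsub>homeo_group\<^esub> g \<in> generate homeo_group ?R"
      using m_inv_homeo_group[OF G_carrier[OF g]] by (simp add: alternating_def)
  qed
  then show ?thesis using m_inv_homeo_group[OF G_carrier[OF g]] by (simp add: alternating_def)
qed

section \<open>Subgroups normalised by the alternating group\<close>

text \<open>The product is the commutator [n, c] of \<open>n\<close> with c = (u a b): read as (n c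
  n^-1) c^-1 it has this form, read as n (c n^-1 c^-1) it lies in \<open>N\<close>.\<close>

lemma commutator_three_cycle:
  assumes N: "subgroup N homeo_group" "N \<subseteq> G"
    and norm: "\<And>d n. d \<in> alternating \<Longrightarrow> n \<in> N \<Longrightarrow> d \<circ> n \<circ> finv d \<in> N"
    and n: "n \<in> N" and c: "{u, a, b} \<subseteq> I" "distinct [u, a, b]"
  shows "three_cycle (n u) (n a) (n b) \<circ> three_cycle b a u \<in> N"
proof -
  let ?c = "three_cycle u a b"
  have "bij n" using n N(2) G_carrier by (auto simp: carrier_homeo_group)
  then have "three_cycle (n u) (n a) (n b) \<circ> three_cycle b a u = n \<circ> (?c \<circ> finv n \<circ> finv ?c)"
    using three_cycle_conj[of n u a b] c(2) by (simp add: inv_three_cycle o_assoc)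
  moreover have "n \<circ> (?c \<circ> finv n \<circ> finv ?c) \<in> N"
    by (intro homeo_subgroupD(3,4)[OF N(1)] norm n three_cycle_in_alternating[OF c])
  ultimately show ?thesis by simp
qed

text \<open>Here [m, (u a b)] is (v a b) (u a b)^-1, which equals (u v a).\<close>

lemma three_cycle_of_moved:
  assumes N: "subgroup N homeo_group" "N \<subseteq> G"
    and norm: "\<And>d n. d \<in> alternating \<Longrightarrow> n \<in> N \<Longrightarrow> d \<circ> n \<circ> finv d \<in> N"
    and m: "m \<in> N" "m u = v" "u \<noteq> v"
    and ab: "{u, a, b} \<subseteq> I" "m a = a" "m b = b" "a \<noteq> b"
  shows "three_cycle u v a \<in> N"
proof -
  have mG: "m \<in> G" using m N by auto
  have "a \<noteq> u" "b \<noteq> u" using m ab by auto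
  moreover have "a \<noteq> v" "b \<noteq> v" using m(2,3) ab(2,3) G_apply(3)[OF mG] by metis+
  ultimately have d: "distinct [u, a, b]" "distinct [v, a, b]" "distinct [b, a, u]" "distinct [u, v, a]"
    using ab m by auto
  have "three_cycle v a b \<circ> three_cycle b a u \<in> N"
    using commutator_three_cycle[OF N norm m(1) ab(1) d(1)] m(2) ab(2,3) by simp
  moreover have "three_cycle v a b \<circ> three_cycle b a u = three_cycle u v a"
    using d by (auto simp: fun_eq_iff three_cycle_apply)
  ultimately show ?thesis by simp
qed

text \<open>The cycle (p q r) moves \<open>p\<close> to \<open>q\<close> and fixes \<open>a\<close>
  and a fresh \<open>b\<close>, so \<open>three_cycle_of_moved\<close> exchanges \<open>r\<close>
  for \<open>a\<close>. The result is stated rotated, with \<open>p\<close> last and thus next to be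
  replaced.\<close>

lemma three_cycle_replace:
  assumes N: "subgroup N homeo_group" "N \<subseteq> G"
    and norm: "\<And>d n. d \<in> alternating \<Longrightarrow> n \<in> N \<Longrightarrow> d \<circ> n \<circ> finv d \<in> N"
    and p: "three_cycle p q r \<in> N" "{p, q, r, a} \<subseteq> I" "distinct [p, q, r]" "a \<notin> {p, q}"
  shows "three_cycle q a p \<in> N"
proof -
  have "three_cycle p q a \<in> N"
  proof (cases "a = r")
    case False
    have "finite {p, q, r, a}" by simp
    then obtain b where b: "b \<in> I" "b \<notin> {p, q, r, a}" by (rule fresh)
    show ?thesis
      using p b False by (intro three_cycle_of_moved[OF N norm p(1), where b = b])
        (auto simp: three_cycle_apply)
  qed (use p in simp)
  then show ?thesis using three_cycle_rotate[of p q a] p by auto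
qed

text \<open>An element \<open>n\<close> of \<open>N\<close> may move infinitely many points, but its
  commutator with a 3-cycle has finite support and so fixes fresh isolated points. This produces one
  3-cycle in \<open>N\<close>, whose letters are then replaced one at a time.\<close>

lemma alternating_least:
  assumes N: "subgroup N homeo_group" "N \<subseteq> G" "N \<noteq> {id}"
    and norm: "\<And>d n. d \<in> alternating \<Longrightarrow> n \<in> N \<Longrightarrow> d \<circ> n \<circ> finv d \<in> N"
  shows "alternating \<subseteq> N"
proof -
  obtain n z where n: "n \<in> N" "n z \<noteq> z"
    by (rule ex_moved_point[OF N(3,2) homeo_subgroupD(2)[OF N(1)]])
  have nG: "n \<in> G" using N n by auto
  obtain A where A: "open A" "closed A" "z \<in> A" "A \<subseteq> UNIV" "n ` A \<inter> A = {}"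
    by (rule moved_clopen[OF nG n(2) open_UNIV UNIV_I])
  have "A \<noteq> {}" using A by blast
  with A(1) obtain x where x: "x \<in> A" "x \<in> I" by (rule I_dense)
  define u where "u = n x"
  have u: "u \<in> I" "u \<noteq> x" using x A I_image[OF nG] by (auto simp: u_def)
  have "finite {x, u}" by simp
  then obtain a b where ab: "a \<in> I" "b \<in> I" "a \<notin> {x, u}" "b \<notin> {x, u}" "a \<noteq> b" by (rule fresh2)
  \<comment> \<open>The commutator of \<open>n\<close> with (x a b). It sends u = n(x) to n(a),
    because \<open>u\<close> differs from \<open>x\<close>, \<open>a\<close> and
    \<open>b\<close>.\<close>
  define m where "m = three_cycle u (n a) (n b) \<circ> three_cycle b a x"
  have m: "m \<in> N"
    unfolding m_def u_def using x ab by (intro commutator_three_cycle[OF N(1,2) norm n(1)]) auto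
  have d: "distinct [u, n a, n b]" "distinct [b, a, x]"
    using ab G_apply(3)[OF nG] by (auto simp: u_def)
  define v where "v = m u"
  have "v = n a" unfolding v_def m_def using d ab u by (simp add: three_cycle_apply)
  then have v: "v \<in> I" "u \<noteq> v" using I_image[OF nG] ab d by auto
  have "finite {u, n a, n b, b, a, x}" by simp
  then obtain c e where ce: "c \<in> I" "e \<in> I" "c \<notin> {u, n a, n b, b, a, x}" "e \<notin> {u, n a, n b, b, a, x}" "c \<noteq> e"
    by (rule fresh2)
  have "m c = c" "m e = e" using ce d by (auto simp: m_def three_cycle_apply)
  then have uvc: "three_cycle u v c \<in> N"
    using ce u by (intro three_cycle_of_moved[OF N(1,2) norm m v_def[symmetric] v(2), where b = e]) auto
  have uvc': "distinct [u, v, c]" using ce v \<open>v = n a\<close> by auto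
  have "three_cycle p q r \<in> N" if pqr: "{p, q, r} \<subseteq> I" "distinct [p, q, r]" for p q r
  proof -
    \<comment> \<open>The letters \<open>p\<close>, \<open>q\<close>, \<open>r\<close> may coincide
      with \<open>u\<close>, \<open>v\<close>, \<open>c\<close>, so the fresh letters
      \<open>s\<close> and \<open>t\<close> come in first as a buffer.\<close>
    have "finite {u, v, c, p, q, r}" by simp
    then obtain s t where st: "s \<in> I" "t \<in> I" "s \<notin> {u, v, c, p, q, r}" "t \<notin> {u, v, c, p, q, r}" "s \<noteq> t"
      by (rule fresh2)
    note replace = three_cycle_replace[OF N(1,2) norm]
    have 1: "three_cycle v s u \<in> N"
      using uvc' st u v ce by (intro replace[OF _ _ uvc]) auto
    have 2: "three_cycle s t v \<in> N" using uvc' st u v by (intro replace[OF _ _ 1]) auto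
    have 3: "three_cycle t p s \<in> N" using uvc' st u v pqr by (intro replace[OF _ _ 2]) auto
    have 4: "three_cycle p q t \<in> N" using st pqr by (intro replace[OF _ _ 3]) auto
    have "three_cycle q r p \<in> N" using st pqr by (intro replace[OF _ _ 4]) auto
    then show ?thesis using three_cycle_rotate[OF pqr(2)] by simp
  qed
  then show ?thesis unfolding alternating_def by (intro homeo.generate_subgroup_incl[OF _ N(1)]) blast
qed

lemma alternating_noncommuting:
  obtains f h where "f \<in> alternating" "h \<in> alternating" "f \<circ> h \<noteq> h \<circ> f"
proof -
  obtain x y where xy: "x \<in> I" "y \<in> I" "x \<noteq> y" by (rule fresh2[OF finite.emptyI])
  have "finite {x, y}" by simp
  then obtain a b where ab: "a \<in> I" "b \<in> I" "a \<notin> {x, y}" "b \<notin> {x, y}" "a \<noteq> b" by (rule fresh2)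
  have d: "distinct [x, y, a]" "distinct [x, y, b]" using xy ab by auto
  have "three_cycle x y a (three_cycle x y b x) \<noteq> three_cycle x y b (three_cycle x y a x)"
    using d ab(5) by (auto simp: three_cycle_apply)
  then have "three_cycle x y a \<circ> three_cycle x y b \<noteq> three_cycle x y b \<circ> three_cycle x y a"
    by (metis comp_apply)
  moreover have "three_cycle x y a \<in> alternating" "three_cycle x y b \<in> alternating"
    using xy ab by (auto intro!: three_cycle_in_alternating)
  ultimately show ?thesis using that by blast
qed

text \<open>Minimality brings every orbit to \<open>y0\<close>, so every point is isolated, and a
  compact discrete space is finite.\<close>

lemma not_compact_minimal:
  assumes min: "minimal_action G"
  shows "\<not> compact (UNIV :: 'a set)"
proof
  assume comp: "compact (UNIV :: 'a set)"
  have "x \<in> I" for x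
  proof -
    have "closure {g x |g. g \<in> G} = UNIV" using min by (simp add: minimal_action_def)
    then have "{y0} \<inter> {g x |g. g \<in> G} \<noteq> {}"
      using open_Int_closure_eq_empty[of "{y0}" "{g x |g. g \<in> G}"] isolated by simp
    then obtain g where g: "g \<in> G" "g x = y0" by blast
    then have "finv g y0 = x" using G_apply(1)[OF g(1), of x] by simp
    then show ?thesis using I_image[OF G_inv[OF g(1)], of y0] isolated by (simp add: I_def)
  qed
  then have "open B" if "B \<in> range (\<lambda>x::'a. {x})" for B using that by (auto simp: I_def)
  moreover have "(UNIV :: 'a set) \<subseteq> \<Union>(range (\<lambda>x. {x}))" by auto
  ultimately obtain F where F: "F \<subseteq> range (\<lambda>x::'a. {x})" "finite F" "UNIV \<subseteq> \<Union>F"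
    using comp by (metis compactE)
  then have "finite (\<Union>F)" by (intro finite_Union) auto
  then show False using F(3) infinite_space by (metis finite_subset)
qed

end

text \<open>The clause on the monolith assumes that there are no isolated points: with one,
  compressible sets have at most one point and \<open>H\<close> is trivial, whereas the monolith is
  the alternating group on the isolated points.\<close>

theorem corollary1p10:
  fixes G H :: "('a::t2_space \<Rightarrow> 'a) set"
  assumes infinite: "infinite (UNIV :: 'a set)"
    and zero_dim: "zero_dimensional TYPE('a)"
    and G_full: "\<exists>K. subgroup K homeo_group \<and> G = piecewise_full K"
    and compressible: "compressible_action G"
    and H_eq: "H = generate homeo_group
                     (\<Union>{rist G Y |Y. open Y \<and> closed Y \<and> compressible_set G Y})"
  shows "almost_simple (homeo_group\<lparr>carrier := G\<rparr>) \<and>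
         ((\<forall>x :: 'a. \<not> open {x}) \<longrightarrow>
           monolith (homeo_group\<lparr>carrier := G\<rparr>) = derived homeo_group H) \<and>
         (compact (UNIV :: 'a set) \<and> minimal_action G \<longrightarrow>
           G = H \<and> fully_compressible_action (derived homeo_group G))"
proof -
  obtain K where K: "subgroup K homeo_group" "G = piecewise_full K" using G_full by blast
  have "piecewise_full_group G"
    using subgroup_piecewise_full[OF K(1)] piecewise_full_idem[of K] zero_dim
    by (intro piecewise_full_group.intro) (simp_all add: K(2))
  then interpret compressible_full_group G
    using compressible by (intro compressible_full_group.intro compressible_full_group_axioms.intro)
  show ?thesis
  proof (cases "\<forall>x :: 'a. \<not> open {x}")
    case True
    then interpret perfect_compressible G by unfold_locales simp
    have H: "H = perfect_compressible.H G" "derived homeo_group H = D"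
      unfolding D_def H_def H_eq by simp_all
    obtain f h where "f \<in> rist D UNIV" "h \<in> rist D UNIV" "f \<circ> h \<noteq> h \<circ> f"
      by (rule rist_D_noncommuting[OF open_UNIV UNIV_not_empty])
    then have fh: "f \<in> D" "h \<in> D" "f \<circ> h \<noteq> h \<circ> f" by (auto simp: rist_def)
    have "monolith (homeo_group\<lparr>carrier := G\<rparr>) = D"
      by (rule monolith_eqI(1)[OF subgroup_D D_subset _ fh], erule (1) D_conj, rule D_least)
    moreover have "almost_simple (homeo_group\<lparr>carrier := G\<rparr>)"
      by (rule monolith_eqI(2)[OF subgroup_D D_subset _ fh], erule (1) D_conj, rule D_least)
    ultimately show ?thesis using H H_eq_G D_fully_compressible by metis
  next
    case False
    then obtain y0 :: 'a where "open {y0}" by blast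
    then interpret isolated_compressible G y0 using infinite by unfold_locales
    obtain f h where fh: "f \<in> alternating" "h \<in> alternating" "f \<circ> h \<noteq> h \<circ> f" by (rule alternating_noncommuting)
    have "almost_simple (homeo_group\<lparr>carrier := G\<rparr>)"
      by (rule monolith_eqI(2)[OF subgroup_alternating alternating_subset _ fh], erule (1) alternating_conj, rule alternating_least)
    \<comment> \<open>The remaining two clauses hold vacuously: there is an isolated point, and
      compactness excludes minimality.\<close>
    then show ?thesis using False not_compact_minimal by blast
  qed
qed

end
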